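(* Let $V>0$, $\lambda>0$, $T>0$. (i) Let $\sigma$ be the weak solution to the Kac equation $\partial_t\sigma+v\,\partial_x\sigma=\lambda(\iota_\sharp\sigma-\sigma)$ with initial datum $\sigma_0\in\mathcal P(\Omega_V)$. Then $(\rho,\omega):=\Pi_V\sigma$ (i.e. $(\rho_t,\omega_t)=\Pi_V\sigma_t$ for every $t$) is the weak solution to the Fourier–Cattaneo system $\partial_t\rho=-\partial_x\omega$, $\partial_t\omega=-V^2\partial_x\rho-2\lambda\omega$ with initial datum $(\rho_0,\omega_0)=\Pi_V\sigma_0$. (ii) Conversely, if $(\rho,\omega)$ is the weak solution to the Fourier–Cattaneo system with initial datum $(\rho_0,\omega_0)\in\mathcal P(\mathbb T)\times\mathcal M(\mathbb T)$ such that $-V\rho_0\le\omega_0\le V\rho_0$ (as measures), then $\sigma:=\Pi_V^{-1}(\rho,\omega)$ is the weak solution to the Kac equation with initial datum $\sigma_0=\Pi_V^{-1}(\rho_0,\omega_0)$.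
   Context: $\mathbb T=\mathbb R/\mathbb Z$, $\Omega_V:=\mathbb T\times\{-V,V\}$, $\iota(x,v):=(x,-v)$. $\mathcal P$, $\mathcal M$: probability measures and finite signed Borel measures with the narrow topology; curves in $C([0,T];\cdot)$ are narrowly continuous. $C^{1,0}(\Omega_V)$: functions that are $C^1$ in $x$ for each $v$. The bijection $\Pi_V:\mathcal M(\Omega_V)\to\mathcal M(\mathbb T)\times\mathcal M(\mathbb T)$ is $(\Pi_V\sigma)(dx):=\bigl(\sum_{v\in\{-V,V\}}\sigma(dx,v),\ \sum_{v\in\{-V,V\}}v\,\sigma(dx,v)\bigr)$, with inverse $(\Pi_V^{-1}(\rho,\omega))(dx,v)=\frac12\bigl(\rho(dx)+\frac1v\omega(dx)\bigr)$. Weak solution of the Kac equation with datum $\sigma_0$: $\sigma\in C([0,T];\mathcal P(\Omega_V))$ with $\sigma|_{t=0}=\sigma_0$ and, for all $\varphi\in C^{1,0}(\Omega_V)$, $0\le s\le t\le T$, $\int\varphi\,d\sigma_t-\int\varphi\,d\sigma_s=\int_s^t\int_{\Omega_V}[v\,\partial_x\varphi+\lambda(\varphi\circ\iota-\varphi)]\,d\sigma_r\,dr$. (It exists and is unique.) Weak solution of the Fourier–Cattaneo system with datum $(\rho_0,\omega_0)$: $(\rho,\omega)\in C([0,T];\mathcal P(\mathbb T))\times C([0,T];\mathcal M(\mathbb T))$ with $(\rho,\omega)|_{t=0}=(\rho_0,\omega_0)$, $\int_0^T\|\omega_t\|_{\mathrm{TV}}\,dt<\infty$, and for all $\varphi,\psi\in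 C^1(\mathbb T)$, $0\le s\le t\le T$, $$\int\varphi\,d\rho_t-\int\varphi\,d\rho_s=\int_s^t\!\int_{\mathbb T}\partial_x\varphi\,d\omega_r\,dr,$$ $$\int\psi\,d\omega_t-\int\psi\,d\omega_s=V^2\!\int_s^t\!\int_{\mathbb T}\partial_x\psi\,d\rho_r\,dr-2\lambda\int_s^t\!\int_{\mathbb T}\psi\,d\omega_r\,dr.$$ (When $-V\rho_0\le\omega_0\le V\rho_0$, it exists and is unique.) *)

theory Defs
  imports "HOL-Probability.Probability"
begin

section \<open>The torus\<close>

quotient_type torus = real / "\<lambda>x y :: real. x - y \<in> \<int>"
proof (rule equivpI)
  show "reflp (\<lambda>x y :: real. x - y \<in> \<int>)" by (simp add: reflp_def)
  show "symp (\<lambda>x y :: real. x - y \<in> \<int>)"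
  proof (rule sympI)
    fix x y :: real
    assume "x - y \<in> \<int>"
    then have "- (x - y) \<in> \<int>" by (rule Ints_minus)
    then show "y - x \<in> \<int>" by simp
  qed
  show "transp (\<lambda>x y :: real. x - y \<in> \<int>)"
  proof (rule transpI)
    fix x y z :: real
    assume "x - y \<in> \<int>" "y - z \<in> \<int>"
    then have "(x - y) + (y - z) \<in> \<int>" by (rule Ints_add)
    then show "x - z \<in> \<int>" by simp
  qed
qed

lift_definition torus_of :: "real \<Rightarrow> torus" is "\<lambda>x. x" .

lemma torus_of_eq_iff: "torus_of x = torus_of y \<longleftrightarrow> x - y \<in> \<int>"
  by transfer simp

instantiation torus :: ab_group_add
begin
lift_definition zero_torus :: torus is "0 :: real" .
lift_definition plus_torus :: "torus \<Rightarrow> torus \<Rightarrow> torus" is "\<lambda>x y :: real. x + y"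
proof -
  fix a b c d :: real
  assume "a - b \<in> \<int>" "c - d \<in> \<int>"
  then have "(a - b) + (c - d) \<in> \<int>" by (rule Ints_add)
  then show "(a + c) - (b + d) \<in> \<int>" by (simp add: algebra_simps)
qed
lift_definition minus_torus :: "torus \<Rightarrow> torus \<Rightarrow> torus" is "\<lambda>x y :: real. x - y"
proof -
  fix a b c d :: real
  assume "a - b \<in> \<int>" "c - d \<in> \<int>"
  then have "(a - b) - (c - d) \<in> \<int>" by (rule Ints_diff)
  then show "(a - c) - (b - d) \<in> \<int>" by (simp add: algebra_simps)
qed
lift_definition uminus_torus :: "torus \<Rightarrow> torus" is "\<lambda>x :: real. - x"
proof -
  fix a b :: real
  assume "a - b \<in> \<int>"
  then have "- (a - b) \<in> \<int>" by (rule Ints_minus)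
  then show "- a - - b \<in> \<int>" by (simp add: algebra_simps)
qed
instance by standard (transfer, simp add: algebra_simps)+
end

text \<open>The quotient topology.\<close>

instantiation torus :: topological_space
begin
definition open_torus :: "torus set \<Rightarrow> bool"
  where "open_torus U \<longleftrightarrow> open (torus_of -` U)"
instance by standard (auto simp: open_torus_def vimage_Union)
end

text \<open>\<open>dx \<phi>\<close> is the derivative of \<open>\<phi>\<close> along the translations of the torus; its value is only
  meaningful for differentiable \<open>\<phi>\<close>.\<close>

definition dx :: "(torus \<Rightarrow> real) \<Rightarrow> torus \<Rightarrow> real"
  where "dx \<phi> x = deriv (\<lambda>h. \<phi> (x + torus_of h)) 0"

definition C1 :: "(torus \<Rightarrow> real) set"
  where "C1 = {\<phi>. (\<forall>x. (\<lambda>h. \<phi> (x + torus_of h)) differentiable (at 0)) \<and>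
                   continuous_on UNIV (dx \<phi>)}"


section \<open>Finite signed measures\<close>

text \<open>Throughout, a measure \<open>M\<close> only serves as a carrier: its space and its measurable sets are used,
  its values are not.  A finite signed measure on \<open>M\<close> is a countably additive real-valued set
  function, extended by 0 to the non-measurable sets; this is the convention of \<^const>\<open>measure\<close>,
  so that a finite measure \<open>N\<close> of the library is the signed measure \<^term>\<open>measure N\<close>.\<close>

definition signed_measures :: "'a measure \<Rightarrow> ('a set \<Rightarrow> real) set"
  where "signed_measures M = {\<mu>. (\<forall>A. A \<notin> sets M \<longrightarrow> \<mu> A = 0) \<and>
    (\<forall>A :: nat \<Rightarrow> 'a set. range A \<subseteq> sets M \<longrightarrow> disjoint_family A \<longrightarrow>
       (\<lambda>i. \<mu> (A i)) sums \<mu> (\<Union>i. A i))}"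

definition prob_measures :: "'a measure \<Rightarrow> ('a set \<Rightarrow> real) set"
  where "prob_measures M = {measure N | N. prob_space N \<and> sets N = sets M}"

text \<open>Jordan decomposition; \<^const>\<open>ennreal\<close> truncates negative numbers to 0.\<close>

definition pos_part :: "'a measure \<Rightarrow> ('a set \<Rightarrow> real) \<Rightarrow> 'a measure"
  where "pos_part M \<mu> = measure_of (space M) (sets M)
           (\<lambda>A. SUP B \<in> {B \<in> sets M. B \<subseteq> A}. ennreal (\<mu> B))"

definition neg_part :: "'a measure \<Rightarrow> ('a set \<Rightarrow> real) \<Rightarrow> 'a measure"
  where "neg_part M \<mu> = pos_part M (\<lambda>A. - \<mu> A)"

definition tv_norm :: "'a measure \<Rightarrow> ('a set \<Rightarrow> real) \<Rightarrow> ennreal"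
  where "tv_norm M \<mu> = emeasure (pos_part M \<mu>) (space M) + emeasure (neg_part M \<mu>) (space M)"

definition signed_integral :: "'a measure \<Rightarrow> ('a set \<Rightarrow> real) \<Rightarrow> ('a \<Rightarrow> real) \<Rightarrow> real"
  where "signed_integral M \<mu> f =
           integral\<^sup>L (pos_part M \<mu>) f - integral\<^sup>L (neg_part M \<mu>) f"

text \<open>The narrow topology is the coarsest one on the signed measures that makes the integrals of
  all bounded continuous functions continuous.\<close>

definition narrow_topology :: "'a::topological_space measure \<Rightarrow> ('a set \<Rightarrow> real) topology"
  where "narrow_topology M = topology_generated_by
    {{\<mu> \<in> signed_measures M. signed_integral M \<mu> f \<in> U} | f U.
       continuous_on (space M) f \<and> bounded (f ` space M) \<and> open U}"

definition curves :: "real \<Rightarrow> 'a::topological_space measure \<Rightarrow> ('a set \<Rightarrow> real) set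
                        \<Rightarrow> (real \<Rightarrow> 'a set \<Rightarrow> real) set"
  where "curves T M S = {\<mu>. continuous_map (top_of_set {0..T})
                                (subtopology (narrow_topology M) S) \<mu>}"


section \<open>Kac equation and Fourier--Cattaneo system\<close>

definition Omega :: "real \<Rightarrow> (torus \<times> real) measure"
  where "Omega V = restrict_space borel (UNIV \<times> {-V, V})"

definition iota :: "torus \<times> real \<Rightarrow> torus \<times> real"
  where "iota = (\<lambda>(x, v). (x, - v))"

definition C10 :: "real \<Rightarrow> (torus \<times> real \<Rightarrow> real) set"
  where "C10 V = {\<phi>. \<forall>v \<in> {-V, V}. (\<lambda>x. \<phi> (x, v)) \<in> C1}"

definition Pi_V :: "real \<Rightarrow> ((torus \<times> real) set \<Rightarrow> real) \<Rightarrow> (torus set \<Rightarrow> real) \<times> (torus set \<Rightarrow> real)"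
  where "Pi_V V \<sigma> = (\<lambda>A. \<Sum>v \<in> {-V, V}. \<sigma> (A \<times> {v}), \<lambda>A. \<Sum>v \<in> {-V, V}. v * \<sigma> (A \<times> {v}))"

definition Pi_V_inv :: "real \<Rightarrow> (torus set \<Rightarrow> real) \<times> (torus set \<Rightarrow> real) \<Rightarrow> (torus \<times> real) set \<Rightarrow> real"
  where "Pi_V_inv V = (\<lambda>(\<rho>, \<omega>) B. if B \<in> sets (Omega V)
           then \<Sum>v \<in> {-V, V}. (\<rho> {x. (x, v) \<in> B} + \<omega> {x. (x, v) \<in> B} / v) / 2 else 0)"

definition kac_weak_solution ::
    "real \<Rightarrow> real \<Rightarrow> real \<Rightarrow> ((torus \<times> real) set \<Rightarrow> real) \<Rightarrow> (real \<Rightarrow> (torus \<times> real) set \<Rightarrow> real) \<Rightarrow> bool"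
  where "kac_weak_solution V lam T \<sigma>\<^sub>0 \<sigma> \<longleftrightarrow>
    \<sigma> \<in> curves T (Omega V) (prob_measures (Omega V)) \<and> \<sigma> 0 = \<sigma>\<^sub>0 \<and>
    (\<forall>\<phi> \<in> C10 V. \<forall>s t. 0 \<le> s \<and> s \<le> t \<and> t \<le> T \<longrightarrow>
       signed_integral (Omega V) (\<sigma> t) \<phi> - signed_integral (Omega V) (\<sigma> s) \<phi> =
       (LBINT r:{s..t}. signed_integral (Omega V) (\<sigma> r)
          (\<lambda>(x, v). v * dx (\<lambda>y. \<phi> (y, v)) x + lam * ((\<phi> \<circ> iota) (x, v) - \<phi> (x, v)))))"

definition fc_weak_solution ::
    "real \<Rightarrow> real \<Rightarrow> real \<Rightarrow> (torus set \<Rightarrow> real) \<times> (torus set \<Rightarrow> real) \<Rightarrow>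
     (real \<Rightarrow> torus set \<Rightarrow> real) \<Rightarrow> (real \<Rightarrow> torus set \<Rightarrow> real) \<Rightarrow> bool"
  where "fc_weak_solution V lam T d\<^sub>0 \<rho> \<omega> \<longleftrightarrow>
    \<rho> \<in> curves T borel (prob_measures borel) \<and>
    \<omega> \<in> curves T borel (signed_measures borel) \<and>
    (\<rho> 0, \<omega> 0) = d\<^sub>0 \<and>
    (\<integral>\<^sup>+ t \<in> {0..T}. tv_norm borel (\<omega> t) \<partial>lborel) < \<infinity> \<and>
    (\<forall>\<phi> \<in> C1. \<forall>s t. 0 \<le> s \<and> s \<le> t \<and> t \<le> T \<longrightarrow>
       signed_integral borel (\<rho> t) \<phi> - signed_integral borel (\<rho> s) \<phi> =
       (LBINT r:{s..t}. signed_integral borel (\<omega> r) (dx \<phi>))) \<and>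
    (\<forall>\<psi> \<in> C1. \<forall>s t. 0 \<le> s \<and> s \<le> t \<and> t \<le> T \<longrightarrow>
       signed_integral borel (\<omega> t) \<psi> - signed_integral borel (\<omega> s) \<psi> =
       V\<^sup>2 * (LBINT r:{s..t}. signed_integral borel (\<rho> r) (dx \<psi>)) -
       2 * lam * (LBINT r:{s..t}. signed_integral borel (\<omega> r) \<psi>))"

text \<open>A curve is \<^emph>\<open>the\<close> weak solution if it is a weak solution and every weak solution
  with the same datum agrees with it on \<open>[0,T]\<close> (values at other times are irrelevant).\<close>

definition the_kac_weak_solution ::
    "real \<Rightarrow> real \<Rightarrow> real \<Rightarrow> ((torus \<times> real) set \<Rightarrow> real) \<Rightarrow> (real \<Rightarrow> (torus \<times> real) set \<Rightarrow> real) \<Rightarrow> bool"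
  where "the_kac_weak_solution V lam T \<sigma>\<^sub>0 \<sigma> \<longleftrightarrow> kac_weak_solution V lam T \<sigma>\<^sub>0 \<sigma> \<and>
    (\<forall>\<sigma>'. kac_weak_solution V lam T \<sigma>\<^sub>0 \<sigma>' \<longrightarrow> (\<forall>t \<in> {0..T}. \<sigma>' t = \<sigma> t))"

definition the_fc_weak_solution ::
    "real \<Rightarrow> real \<Rightarrow> real \<Rightarrow> (torus set \<Rightarrow> real) \<times> (torus set \<Rightarrow> real) \<Rightarrow>
     (real \<Rightarrow> torus set \<Rightarrow> real) \<Rightarrow> (real \<Rightarrow> torus set \<Rightarrow> real) \<Rightarrow> bool"
  where "the_fc_weak_solution V lam T d\<^sub>0 \<rho> \<omega> \<longleftrightarrow> fc_weak_solution V lam T d\<^sub>0 \<rho> \<omega> \<and>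
    (\<forall>\<rho>' \<omega>'. fc_weak_solution V lam T d\<^sub>0 \<rho>' \<omega>' \<longrightarrow> (\<forall>t \<in> {0..T}. \<rho>' t = \<rho> t \<and> \<omega>' t = \<omega> t))"


section \<open>Consistency of the encoding\<close>

text \<open>For a finite measure of the library, the positive part is the measure itself, and the
  signed integral is the Lebesgue integral.\<close>

lemma pos_part_measure:
  assumes "finite_measure N" "sets N = sets M"
  shows "pos_part M (measure N) = N"
proof -
  interpret finite_measure N by fact
  have sp: "space M = space N" using assms(2)[symmetric] by (rule sets_eq_imp_space_eq)
  have *: "(SUP B \<in> {B \<in> sets M. B \<subseteq> A}. ennreal (measure N B)) = emeasure N A"
    if "A \<in> sets N" for A
  proof (rule antisym)
    show "(SUP B \<in> {B \<in> sets M. B \<subseteq> A}. ennreal (measure N B)) \<le> emeasure N A"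
    proof (rule SUP_least)
      fix B assume "B \<in> {B \<in> sets M. B \<subseteq> A}"
      then show "ennreal (measure N B) \<le> emeasure N A"
        unfolding emeasure_eq_measure[symmetric] using that by (intro emeasure_mono) blast+
    qed
    show "emeasure N A \<le> (SUP B \<in> {B \<in> sets M. B \<subseteq> A}. ennreal (measure N B))"
      by (rule SUP_upper2[where i=A]) (use that assms(2) in \<open>simp_all add: emeasure_eq_measure\<close>)
  qed
  have "pos_part M (measure N) = measure_of (space N) (sets N) (emeasure N)"
    unfolding pos_part_def sp assms(2)[symmetric]
  proof (rule measure_of_eq)
    show "sets N \<subseteq> Pow (space N)" by (rule sets.space_closed)
    fix A assume "A \<in> sigma_sets (space N) (sets N)"
    then have "A \<in> sets N" by (simp only: sets.sigma_sets_eq)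
    from *[OF this] show "(SUP B \<in> {B \<in> sets N. B \<subseteq> A}. ennreal (measure N B)) = emeasure N A"
      by (simp only: assms(2))
  qed
  then show ?thesis by (simp add: measure_of_of_measure)
qed

lemma neg_part_measure: "neg_part M (measure N) = null_measure M"
proof -
  have "(SUP B \<in> {B \<in> sets M. B \<subseteq> A}. ennreal (- measure N B)) = 0" for A
    by (rule antisym, rule SUP_least) (simp_all add: ennreal_neg)
  then have "neg_part M (measure N) = measure_of (space M) (sets M) (\<lambda>_. 0)"
    unfolding neg_part_def pos_part_def by simp
  then show ?thesis by (simp add: null_measure_def)
qed

lemma signed_integral_measure:
  assumes "finite_measure N" "sets N = sets M"
  shows "signed_integral M (measure N) f = integral\<^sup>L N f"
  unfolding signed_integral_def pos_part_measure[OF assms] neg_part_measure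
  by (simp add: integral_null_measure)

lemma signed_measures_measure:
  assumes "finite_measure N" "sets N = sets M"
  shows "measure N \<in> signed_measures M"
proof -
  interpret finite_measure N by fact
  show ?thesis
    unfolding signed_measures_def
    using assms(2) finite_measure_UNION by (auto simp: measure_notin_sets)
qed

lemma signed_measure_empty:
  assumes "\<mu> \<in> signed_measures M"
  shows "\<mu> {} = 0"
proof -
  have "(\<lambda>i::nat. \<mu> ((\<lambda>_. {}) i)) sums \<mu> (\<Union>i::nat. (\<lambda>_. {}) i)"
    using assms unfolding signed_measures_def by (auto simp: disjoint_family_on_def)
  then have "(\<lambda>i::nat. \<mu> {}) sums \<mu> {}" by simp
  then have "(\<lambda>i::nat. \<mu> {}) \<longlonglongrightarrow> 0" by (rule summable_LIMSEQ_zero[OF sums_summable])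
  then show ?thesis by (simp add: LIMSEQ_const_iff)
qed

lemma signed_measure_Un:
  assumes "\<mu> \<in> signed_measures M" "A \<in> sets M" "B \<in> sets M" "A \<inter> B = {}"
  shows "\<mu> (A \<union> B) = \<mu> A + \<mu> B"
proof -
  have "range (binaryset A B) \<subseteq> sets M" "disjoint_family (binaryset A B)"
    using assms(2-4) by (auto simp: range_binaryset_eq disjoint_family_on_def binaryset_def)
  then have "(\<lambda>i. \<mu> (binaryset A B i)) sums \<mu> (\<Union>i. binaryset A B i)"
    using assms(1) unfolding signed_measures_def by blast
  moreover have "(\<lambda>i. \<mu> (binaryset A B i)) sums (\<mu> A + \<mu> B)"
    using signed_measure_empty[OF assms(1)] by (rule binaryset_sums)
  ultimately show ?thesis by (simp add: UN_binaryset_eq sums_unique2)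
qed

text \<open>The set function defining the positive part is a measure.\<close>

lemma emeasure_pos_part:
  assumes mu: "\<mu> \<in> signed_measures M" and "A \<in> sets M"
  shows "emeasure (pos_part M \<mu>) A = (SUP B \<in> {B \<in> sets M. B \<subseteq> A}. ennreal (\<mu> B))"
proof -
  define \<nu> where "\<nu> A = (SUP B \<in> {B \<in> sets M. B \<subseteq> A}. ennreal (\<mu> B))" for A
  have upper: "ennreal (\<mu> B) \<le> \<nu> A" if "B \<in> sets M" "B \<subseteq> A" for A B
    unfolding \<nu>_def using that by (intro SUP_upper) blast
  have mono: "\<nu> A \<le> \<nu> B" if "A \<subseteq> B" for A B
    unfolding \<nu>_def by (rule SUP_subset_mono) (use that in auto)
  have empty: "\<nu> {} = 0"
    unfolding \<nu>_def using signed_measure_empty[OF mu] by (intro antisym SUP_least) auto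
  have super: "\<nu> A + \<nu> B \<le> \<nu> (A \<union> B)" if disj: "A \<inter> B = {}" for A B
  proof -
    have ne: "{D \<in> sets M. D \<subseteq> E} \<noteq> {}" for E by blast
    have *: "ennreal (\<mu> C) + ennreal (\<mu> D) \<le> \<nu> (A \<union> B)"
      if C: "C \<in> sets M" "C \<subseteq> A" and D: "D \<in> sets M" "D \<subseteq> B" for C D
    proof (cases "\<mu> C \<ge> 0 \<and> \<mu> D \<ge> 0")
      case True
      have "C \<inter> D = {}" using C D disj by blast
      from signed_measure_Un[OF mu C(1) D(1) this] True
      have "ennreal (\<mu> C) + ennreal (\<mu> D) = ennreal (\<mu> (C \<union> D))" by simp
      also have "\<dots> \<le> \<nu> (A \<union> B)" by (rule upper) (use C D in auto)
      finally show ?thesis .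
    next
      case False
      moreover have "ennreal (\<mu> C) \<le> \<nu> (A \<union> B)" "ennreal (\<mu> D) \<le> \<nu> (A \<union> B)"
        using C D by (auto intro!: upper)
      ultimately show ?thesis by (auto simp: ennreal_neg not_le)
    qed
    have "\<nu> A + \<nu> B = (SUP C \<in> {C \<in> sets M. C \<subseteq> A}. ennreal (\<mu> C) + \<nu> B)"
      unfolding \<nu>_def by (rule ennreal_SUP_add_left[OF ne, symmetric])
    also have "\<dots> \<le> \<nu> (A \<union> B)"
    proof (rule SUP_least)
      fix C assume C: "C \<in> {C \<in> sets M. C \<subseteq> A}"
      have "ennreal (\<mu> C) + \<nu> B = (SUP D \<in> {D \<in> sets M. D \<subseteq> B}. ennreal (\<mu> C) + ennreal (\<mu> D))"
        unfolding \<nu>_def by (rule ennreal_SUP_add_right[OF ne])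
      also have "\<dots> \<le> \<nu> (A \<union> B)" using C by (intro SUP_least *) auto
      finally show "ennreal (\<mu> C) + \<nu> B \<le> \<nu> (A \<union> B)" .
    qed
    finally show ?thesis .
  qed
  have "countably_additive (sets M) \<nu>"
  proof (rule countably_additiveI, rule antisym)
    fix A :: "nat \<Rightarrow> 'a set"
    assume A: "range A \<subseteq> sets M" "disjoint_family A"
    have "(\<Sum>i<n. \<nu> (A i)) \<le> \<nu> (\<Union>i<n. A i)" for n
    proof (induction n)
      case (Suc n)
      have "A n \<inter> A i = {}" if "i < n" for i
        using A(2) that unfolding disjoint_family_on_def by (metis UNIV_I less_irrefl)
      then have "A n \<inter> (\<Union>i<n. A i) = {}" by blast
      then have "\<nu> (A n) + \<nu> (\<Union>i<n. A i) \<le> \<nu> (A n \<union> (\<Union>i<n. A i))" by (rule super)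
      moreover have "A n \<union> (\<Union>i<n. A i) = (\<Union>i<Suc n. A i)" by (simp add: lessThan_Suc)
      moreover have "(\<Sum>i<Suc n. \<nu> (A i)) \<le> \<nu> (A n) + \<nu> (\<Union>i<n. A i)"
        using add_left_mono[OF Suc, of "\<nu> (A n)"] by (simp add: add.commute)
      ultimately show ?case by (metis order_trans)
    qed (simp add: empty)
    then have "(\<Sum>i<n. \<nu> (A i)) \<le> \<nu> (\<Union>i. A i)" for n
      by (rule order_trans) (auto intro!: mono)
    then show "(\<Sum>i. \<nu> (A i)) \<le> \<nu> (\<Union>i. A i)"
      unfolding suminf_eq_SUP by (intro SUP_least)
    show "\<nu> (\<Union>i. A i) \<le> (\<Sum>i. \<nu> (A i))"
      unfolding \<nu>_def[of "\<Union>i. A i"]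
    proof (rule SUP_least)
      fix B assume B: "B \<in> {B \<in> sets M. B \<subseteq> (\<Union>i. A i)}"
      have "range (\<lambda>i. B \<inter> A i) \<subseteq> sets M" "disjoint_family (\<lambda>i. B \<inter> A i)"
        using A B by (auto simp: disjoint_family_on_def)
      then have "(\<lambda>i. \<mu> (B \<inter> A i)) sums \<mu> (\<Union>i. B \<inter> A i)"
        using mu unfolding signed_measures_def by blast
      moreover have "(\<Union>i. B \<inter> A i) = B" using B by auto
      ultimately have "(\<lambda>n. \<Sum>i<n. \<mu> (B \<inter> A i)) \<longlonglongrightarrow> \<mu> B" by (simp add: sums_def)
      then have lim: "(\<lambda>n. ennreal (\<Sum>i<n. \<mu> (B \<inter> A i))) \<longlonglongrightarrow> ennreal (\<mu> B)"
        by (rule tendsto_ennrealI)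
      have "ennreal (\<Sum>i<n. \<mu> (B \<inter> A i)) \<le> (\<Sum>i. \<nu> (A i))" for n
      proof -
        have "ennreal (\<Sum>i<n. \<mu> (B \<inter> A i)) \<le> ennreal (\<Sum>i<n. max 0 (\<mu> (B \<inter> A i)))"
          by (intro ennreal_leI sum_mono) simp
        also have "\<dots> = (\<Sum>i<n. ennreal (max 0 (\<mu> (B \<inter> A i))))"
          by (rule sum_ennreal[symmetric]) simp
        also have "\<dots> = (\<Sum>i<n. ennreal (\<mu> (B \<inter> A i)))"
          by (rule sum.cong) (auto simp: max_def ennreal_neg)
        also have "\<dots> \<le> (\<Sum>i<n. \<nu> (A i))"
          using A B by (intro sum_mono upper) auto
        also have "\<dots> \<le> (\<Sum>i. \<nu> (A i))" by (rule sum_le_suminf) auto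
        finally show ?thesis .
      qed
      then show "ennreal (\<mu> B) \<le> (\<Sum>i. \<nu> (A i))"
        by (intro LIMSEQ_le_const2[OF lim]) auto
    qed
  qed
  moreover have "positive (sets M) \<nu>" using empty by (simp add: positive_def)
  moreover have "pos_part M \<mu> = measure_of (space M) (sets M) \<nu>"
    unfolding pos_part_def \<nu>_def ..
  ultimately show ?thesis
    using emeasure_measure_of_sigma[OF sets.sigma_algebra_axioms _ _ assms(2), of \<nu>]
    by (simp add: \<nu>_def)
qed

text \<open>\<^const>\<open>Pi_V\<close> and \<^const>\<open>Pi_V_inv\<close> are mutually inverse.\<close>

lemma section_sets_Omega:
  assumes "B \<in> sets (Omega V)"
  shows "{x. (x, v) \<in> B} \<in> sets borel"
proof -
  have B: "B \<in> sets borel"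
  proof -
    have "(UNIV \<times> {-V, V} :: (torus \<times> real) set) \<in> sets borel"
      by (intro borel_closed closed_Times) auto
    with assms show ?thesis by (auto simp: Omega_def sets_restrict_space)
  qed
  have "(\<lambda>x :: torus. (x, v)) \<in> borel \<rightarrow>\<^sub>M borel"
    by (intro borel_measurable_continuous_onI continuous_intros)
  from measurable_sets[OF this B] show ?thesis by (simp add: vimage_def)
qed

lemma Times_sets_Omega:
  assumes "v \<in> {-V, V}"
  shows "A \<times> {v} \<in> sets (Omega V) \<longleftrightarrow> A \<in> sets borel"
proof
  assume "A \<times> {v} \<in> sets (Omega V)"
  from section_sets_Omega[OF this, of v] show "A \<in> sets borel" by simp
next
  assume A: "A \<in> sets borel"
  have "fst \<in> (borel :: (torus \<times> real) measure) \<rightarrow>\<^sub>M borel"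
    by (intro borel_measurable_continuous_onI continuous_intros)
  from measurable_sets[OF this A] have 1: "A \<times> UNIV \<in> sets (borel :: (torus \<times> real) measure)"
    by (simp add: vimage_fst)
  have 2: "(UNIV \<times> {v} :: (torus \<times> real) set) \<in> sets borel"
    by (intro borel_closed closed_Times) auto
  have "A \<times> {v} = (UNIV \<times> {-V, V}) \<inter> ((A \<times> UNIV) \<inter> (UNIV \<times> {v}))"
    using assms by auto
  then show "A \<times> {v} \<in> sets (Omega V)"
    unfolding Omega_def sets_restrict_space using sets.Int[OF 1 2] by blast
qed

lemma Pi_V_inv_Pi_V:
  assumes "V > 0" "\<sigma> \<in> signed_measures (Omega V)"
  shows "Pi_V_inv V (Pi_V V \<sigma>) = \<sigma>"
proof
  fix B
  show "Pi_V_inv V (Pi_V V \<sigma>) B = \<sigma> B"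
  proof (cases "B \<in> sets (Omega V)")
    case True
    let ?S = "\<lambda>v. {x. (x, v) \<in> B} \<times> {v}"
    have "B \<subseteq> UNIV \<times> {-V, V}"
      using sets.sets_into_space[OF True] by (auto simp: Omega_def space_restrict_space)
    then have "B = ?S (-V) \<union> ?S V" by auto
    moreover have "?S (-V) \<in> sets (Omega V)" "?S V \<in> sets (Omega V)"
      using section_sets_Omega[OF True] by (simp_all add: Times_sets_Omega)
    moreover have "?S (-V) \<inter> ?S V = {}" using assms(1) by auto
    ultimately have *: "\<sigma> B = \<sigma> (?S (-V)) + \<sigma> (?S V)"
      using signed_measure_Un[OF assms(2)] by metis
    show ?thesis
      unfolding * using True assms(1)
      by (simp add: Pi_V_inv_def Pi_V_def eq_neg_iff_add_eq_0 field_simps)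
  next
    case False
    then show ?thesis using assms(2) by (simp add: Pi_V_inv_def Pi_V_def signed_measures_def)
  qed
qed

lemma Pi_V_Pi_V_inv:
  assumes "V > 0" "\<rho> \<in> signed_measures borel" "\<omega> \<in> signed_measures borel"
  shows "Pi_V V (Pi_V_inv V (\<rho>, \<omega>)) = (\<rho>, \<omega>)"
proof -
  have emp: "\<rho> {} = 0" "\<omega> {} = 0"
    using assms by (auto intro: signed_measure_empty)
  have off: "\<rho> A = 0 \<and> \<omega> A = 0" if "A \<notin> sets borel" for A
    using that assms by (simp add: signed_measures_def)
  have *: "Pi_V_inv V (\<rho>, \<omega>) (A \<times> {v}) = (\<rho> A + \<omega> A / v) / 2" if "v \<in> {-V, V}" for A v
    using that assms(1) off[of A] emp Times_sets_Omega[OF that, of A]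
    by (auto simp: Pi_V_inv_def)
  show ?thesis
    using assms(1) by (auto simp: Pi_V_def * fun_eq_iff eq_neg_iff_add_eq_0 field_simps)
qed

end

theory Submission
  imports Defs
begin

text \<open>The equations for \<open>(\<rho>, \<omega>)\<close> and for \<open>\<sigma>\<close> are linear combinations of each other: test the Kac equation
  with \<open>\<phi>(x)\<close> and \<open>v \<phi>(x)\<close>, and conversely.  What has to be shown besides is that solutions of the
  Fourier--Cattaneo system are unique and that \<open>V \<rho> \<plusminus> \<omega>\<close> stay nonnegative.  Both follow from a minimum
  principle: for a test function \<open>\<eta>\<close> the functions \<open>g\<^sub>\<plusminus>(t,x) = \<integral> \<eta>(x + y) (V \<rho>\<^sub>t \<plusminus> \<omega>\<^sub>t)(dy)\<close> are
  classical solutions of \<open>\<partial>\<^sub>t g\<^sub>\<plusminus> = \<plusminus>V \<partial>\<^sub>x g\<^sub>\<plusminus> + \<lambda>(g\<^sub>\<mp> - g\<^sub>\<plusminus>)\<close>, and this system preserves nonnegativity.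
  Test functions \<open>\<eta>\<close> for which \<open>\<eta>(x + y)\<close> is a finite sum of products \<open>a(x) b(y)\<close> make \<open>g\<^sub>\<plusminus>\<close> jointly
  continuous at no cost, and they are dense by the Stone--Weierstrass theorem.\<close>

section \<open>Signed measures\<close>

text \<open>\<open>the_fc_weak_solution\<close> and \<open>the_kac_weak_solution\<close> contain
  uniqueness, so it has to be proved together with the equations. Only the Fourier--Cattaneo side
  needs an argument: \<open>Pi_V\<close> is injective and carries Kac solutions to Fourier--Cattaneo
  solutions. The nonnegativity of V \<rho> \<plusminus> \<omega> is what makes
  \<open>Pi_V_inv\<close> return probability measures, since these are 2V times the two velocity
  slices of \<sigma>. Two obstacles shape the rest. \<open>signed_integral\<close> is defined
  through Jordan parts, which do not add up when measures are added or mapped, so even linearity in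
  the measure is not immediate; integrals are therefore handled as functionals determined by their
  values on indicators. Moreover, narrow continuity controls one test function at a time, whereas a
  minimum over time and space requires joint continuity. Restricting the test functions removes this
  difficulty, at the price of extending positivity from these functions to all Borel sets
  afterwards.\<close>

lemma signed_measure_sums:
  assumes "\<mu> \<in> signed_measures M" "range A \<subseteq> sets M" "disjoint_family (A :: nat \<Rightarrow> 'a set)"
  shows "(\<lambda>i. \<mu> (A i)) sums \<mu> (\<Union>i. A i)"
  using assms unfolding signed_measures_def by blast

lemma signed_measure_notin: "\<mu> \<in> signed_measures M \<Longrightarrow> A \<notin> sets M \<Longrightarrow> \<mu> A = 0"
  unfolding signed_measures_def by blast

lemma signed_measure_Diff:
  assumes "\<mu> \<in> signed_measures M" "A \<in> sets M" "B \<in> sets M" "B \<subseteq> A"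
  shows "\<mu> (A - B) = \<mu> A - \<mu> B"
proof -
  have "\<mu> ((A - B) \<union> B) = \<mu> (A - B) + \<mu> B"
    using assms by (intro signed_measure_Un) auto
  moreover have "(A - B) \<union> B = A" using assms(4) by blast
  ultimately show ?thesis by simp
qed

lemma signed_measures_add:
  assumes "\<mu> \<in> signed_measures M" "\<nu> \<in> signed_measures M"
  shows "(\<lambda>A. \<mu> A + \<nu> A) \<in> signed_measures M"
  using assms unfolding signed_measures_def by (auto intro!: sums_add)

lemma signed_measures_scale:
  assumes "\<mu> \<in> signed_measures M"
  shows "(\<lambda>A. c * \<mu> A) \<in> signed_measures M"
  using assms unfolding signed_measures_def by (auto intro!: sums_mult)

lemma signed_measures_uminus:
  "\<mu> \<in> signed_measures M \<Longrightarrow> (\<lambda>A. - \<mu> A) \<in> signed_measures M"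
  using signed_measures_scale[of \<mu> M "-1"] by simp

lemma signed_measures_diff:
  "\<mu> \<in> signed_measures M \<Longrightarrow> \<nu> \<in> signed_measures M \<Longrightarrow> (\<lambda>A. \<mu> A - \<nu> A) \<in> signed_measures M"
  using signed_measures_add[OF _ signed_measures_uminus, of \<mu> M \<nu>] by simp

lemma prob_measures_subset_signed: "prob_measures M \<subseteq> signed_measures M"
  unfolding prob_measures_def
  by (auto intro!: signed_measures_measure prob_space.axioms(1) simp: prob_space.finite_measure)

text \<open>The push-forward along h; the case distinction enforces the convention that a signed
  measure is 0 off the measurable sets. It serves for the embeddings of the torus at velocity V and
  -V, from which \<open>Pi_V_inv\<close> is assembled.\<close>

lemma signed_measures_image:
  assumes mu: "\<mu> \<in> signed_measures M" and h: "h \<in> M \<rightarrow>\<^sub>M N"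
  shows "(\<lambda>A. if A \<in> sets N then \<mu> (h -` A \<inter> space M) else 0) \<in> signed_measures N"
  unfolding signed_measures_def
proof (safe, simp, goal_cases)
  case (1 A)
  have U: "(\<Union>i. A i) \<in> sets N" using 1 by auto
  have "(\<lambda>i. \<mu> (h -` A i \<inter> space M)) sums \<mu> (\<Union>i. h -` A i \<inter> space M)"
    using 1 h by (intro signed_measure_sums[OF mu])
      (auto simp: disjoint_family_on_def image_subset_iff intro: measurable_sets)
  moreover have "(\<Union>i. h -` A i \<inter> space M) = h -` (\<Union>i. A i) \<inter> space M" by blast
  moreover have "A i \<in> sets N" for i using 1 by auto
  ultimately show ?case using U by simp
qed

section \<open>Finiteness of the Jordan parts and the Jordan decomposition\<close>

lemma sets_pos_part [simp]: "sets (pos_part M \<mu>) = sets M"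
  by (simp add: pos_part_def)

lemma space_pos_part [simp]: "space (pos_part M \<mu>) = space M"
  by (simp add: pos_part_def)

lemma sets_neg_part [simp]: "sets (neg_part M \<mu>) = sets M"
  by (simp add: neg_part_def)

lemma space_neg_part [simp]: "space (neg_part M \<mu>) = space M"
  by (simp add: neg_part_def)

text \<open>Iterating this splitting would give infinitely many disjoint sets with \<open>\<bar>\<mu>\<bar> > 1\<close>, contradicting
  countable additivity.\<close>

lemma infinite_pos_part_split:
  assumes mu: "\<mu> \<in> signed_measures M" and E: "E \<in> sets M" "emeasure (pos_part M \<mu>) E = \<infinity>"
  shows "\<exists>F \<in> sets M. F \<subseteq> E \<and> emeasure (pos_part M \<mu>) F = \<infinity> \<and> \<bar>\<mu> (E - F)\<bar> > 1"
proof -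
  \<comment> \<open>The threshold makes both halves large: \<mu> B > 1, and \<mu> (E - B) = \<mu> E
    - \<mu> B < -1. So whichever half keeps the infinite positive part, the discarded one has
    absolute value above 1.\<close>
  have "ennreal (\<bar>\<mu> E\<bar> + 1) < (SUP B \<in> {B \<in> sets M. B \<subseteq> E}. ennreal (\<mu> B))"
    using E(2) emeasure_pos_part[OF mu E(1)] by (metis ennreal_less_top infinity_ennreal_def)
  then obtain B where B: "B \<in> sets M" "B \<subseteq> E" "ennreal (\<bar>\<mu> E\<bar> + 1) < ennreal (\<mu> B)"
    by (auto simp: less_SUP_iff)
  have muB: "\<mu> B > \<bar>\<mu> E\<bar> + 1" using B(3) by (subst (asm) ennreal_less_iff) auto
  have muEB: "\<mu> (E - B) = \<mu> E - \<mu> B" using signed_measure_Diff[OF mu E(1) B(1,2)] .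
  have "emeasure (pos_part M \<mu>) B + emeasure (pos_part M \<mu>) (E - B) = emeasure (pos_part M \<mu>) (B \<union> (E - B))"
    using E B by (intro plus_emeasure) auto
  also have "B \<union> (E - B) = E" using B(2) by blast
  finally have "emeasure (pos_part M \<mu>) B = \<infinity> \<or> emeasure (pos_part M \<mu>) (E - B) = \<infinity>"
    using E(2) by simp
  then show ?thesis
  proof
    assume "emeasure (pos_part M \<mu>) B = \<infinity>"
    then show ?thesis using B muB muEB by (intro bexI[of _ B]) auto
  next
    assume "emeasure (pos_part M \<mu>) (E - B) = \<infinity>"
    moreover have "E - (E - B) = B" using B(2) by blast
    ultimately show ?thesis using E B muB by (intro bexI[of _ "E - B"]) auto
  qed
qed

lemma finite_measure_pos_part:
  assumes mu: "\<mu> \<in> signed_measures M"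
  shows "finite_measure (pos_part M \<mu>)"
proof (rule finite_measureI, rule notI)
  let ?\<nu> = "pos_part M \<mu>"
  assume "emeasure ?\<nu> (space ?\<nu>) = \<infinity>"
  then have 0: "space M \<in> sets M \<and> emeasure ?\<nu> (space M) = \<infinity>" by simp
  define P where "P F \<longleftrightarrow> F \<in> sets M \<and> emeasure ?\<nu> F = \<infinity>" for F
  have "\<exists>E. \<forall>n. P (E n) \<and> (E (Suc n) \<subseteq> E n \<and> \<bar>\<mu> (E n - E (Suc n))\<bar> > 1)"
  proof (rule dependent_nat_choice)
    show "\<exists>x. P x" using 0 unfolding P_def by blast
    show "\<exists>F. P F \<and> (F \<subseteq> E \<and> \<bar>\<mu> (E - F)\<bar> > 1)" if "P E" for E
      using infinite_pos_part_split[OF mu] that unfolding P_def by blast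
  qed
  then obtain E where E: "\<And>n. P (E n)" "\<And>n. E (Suc n) \<subseteq> E n" "\<And>n. \<bar>\<mu> (E n - E (Suc n))\<bar> > 1"
    by blast
  have "decseq E" using E(2) by (rule decseq_SucI)
  have disj: "(E m - E (Suc m)) \<inter> (E n - E (Suc n)) = {}" if "m < n" for m n
    using decseqD[OF \<open>decseq E\<close>, of "Suc m" n] that by auto
  have "disjoint_family (\<lambda>n. E n - E (Suc n))"
    unfolding disjoint_family_on_def using disj by (metis inf_commute linorder_neqE_nat)
  moreover have "range (\<lambda>n. E n - E (Suc n)) \<subseteq> sets M"
    using E(1) unfolding P_def by auto
  ultimately have "(\<lambda>n. \<mu> (E n - E (Suc n))) sums \<mu> (\<Union>n. E n - E (Suc n))"
    by (intro signed_measure_sums[OF mu])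
  \<comment> \<open>The terms of a convergent series tend to 0, whereas each of these has absolute
    value above 1.\<close>
  then have "(\<lambda>n. \<mu> (E n - E (Suc n))) \<longlonglongrightarrow> 0"
    by (intro summable_LIMSEQ_zero sums_summable)
  then have "\<forall>\<^sub>F n in sequentially. \<bar>\<mu> (E n - E (Suc n))\<bar> < 1"
    by (auto simp: tendsto_iff dist_real_def)
  then show False using E(3) by (meson eventually_sequentially le_refl less_asym)
qed

lemma finite_measure_neg_part:
  "\<mu> \<in> signed_measures M \<Longrightarrow> finite_measure (neg_part M \<mu>)"
  unfolding neg_part_def by (intro finite_measure_pos_part signed_measures_uminus)

text \<open>The map from B to A - B permutes the measurable subsets of A, and \<mu> B = \<mu> A -
  \<mu> (A - B). Taking suprema over B shows that the positive part of A is \<mu> A plus the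
  negative part of A, without a Hahn set; finiteness of both parts allows the subtraction.\<close>

lemma Jordan_decomposition:
  assumes mu: "\<mu> \<in> signed_measures M" and A: "A \<in> sets M"
  shows "\<mu> A = measure (pos_part M \<mu>) A - measure (neg_part M \<mu>) A"
proof -
  interpret p: finite_measure "pos_part M \<mu>" by (rule finite_measure_pos_part[OF mu])
  interpret n: finite_measure "neg_part M \<mu>" by (rule finite_measure_neg_part[OF mu])
  have le: "\<mu> B \<le> measure (pos_part M \<mu>) A" if "B \<in> sets M" "B \<subseteq> A" for B
  proof -
    have "ennreal (\<mu> B) \<le> emeasure (pos_part M \<mu>) A"
      unfolding emeasure_pos_part[OF mu A] using that by (intro SUP_upper) blast
    then show ?thesis unfolding p.emeasure_eq_measure by simp
  qed
  have len: "- \<mu> B \<le> measure (neg_part M \<mu>) A" if "B \<in> sets M" "B \<subseteq> A" for B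
  proof -
    have "ennreal (- \<mu> B) \<le> emeasure (neg_part M \<mu>) A"
      unfolding neg_part_def emeasure_pos_part[OF signed_measures_uminus[OF mu] A]
      using that by (intro SUP_upper) blast
    then show ?thesis unfolding n.emeasure_eq_measure by simp
  qed
  have leI: "measure (pos_part M \<mu>) A \<le> c" if "\<And>B. B \<in> sets M \<Longrightarrow> B \<subseteq> A \<Longrightarrow> \<mu> B \<le> c" for c
  proof -
    have "c \<ge> 0" using that[of "{}"] signed_measure_empty[OF mu] by simp
    have "emeasure (pos_part M \<mu>) A \<le> ennreal c"
      unfolding emeasure_pos_part[OF mu A] using that by (intro SUP_least ennreal_leI) auto
    then show ?thesis unfolding p.emeasure_eq_measure using \<open>c \<ge> 0\<close> by simp
  qed
  have leIn: "measure (neg_part M \<mu>) A \<le> c" if "\<And>B. B \<in> sets M \<Longrightarrow> B \<subseteq> A \<Longrightarrow> - \<mu> B \<le> c" for c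
  proof -
    have "c \<ge> 0" using that[of "{}"] signed_measure_empty[OF mu] by simp
    have "emeasure (neg_part M \<mu>) A \<le> ennreal c"
      unfolding neg_part_def emeasure_pos_part[OF signed_measures_uminus[OF mu] A]
      using that by (intro SUP_least ennreal_leI) auto
    then show ?thesis unfolding n.emeasure_eq_measure using \<open>c \<ge> 0\<close> by simp
  qed
  have "measure (pos_part M \<mu>) A \<le> \<mu> A + measure (neg_part M \<mu>) A"
  proof (rule leI)
    fix B assume B: "B \<in> sets M" "B \<subseteq> A"
    show "\<mu> B \<le> \<mu> A + measure (neg_part M \<mu>) A"
      using len[of "A - B"] signed_measure_Diff[OF mu A B] A B by auto
  qed
  moreover have "measure (neg_part M \<mu>) A \<le> measure (pos_part M \<mu>) A - \<mu> A"
  proof (rule leIn)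
    fix B assume B: "B \<in> sets M" "B \<subseteq> A"
    show "- \<mu> B \<le> measure (pos_part M \<mu>) A - \<mu> A"
      using le[of "A - B"] signed_measure_Diff[OF mu A B] A B by auto
  qed
  ultimately show ?thesis by simp
qed

text \<open>No subset has negative mass, so the negative part vanishes. Both sides are 0 off the
  measurable sets, hence they agree as set functions and the integration theory of measures becomes
  available.\<close>

lemma nonneg_signed_measure_eq_measure:
  assumes mu: "\<mu> \<in> signed_measures M" and nonneg: "\<And>A. A \<in> sets M \<Longrightarrow> \<mu> A \<ge> 0"
  shows "\<mu> = measure (pos_part M \<mu>)"
proof
  fix A
  show "\<mu> A = measure (pos_part M \<mu>) A"
  proof (cases "A \<in> sets M")
    case True
    have "emeasure (neg_part M \<mu>) A = 0"
      unfolding neg_part_def emeasure_pos_part[OF signed_measures_uminus[OF mu] True]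
      using nonneg by (intro antisym SUP_least) (auto simp: ennreal_neg)
    then show ?thesis using Jordan_decomposition[OF mu True] by (simp add: measure_def)
  qed (simp add: signed_measure_notin[OF mu] measure_notin_sets)
qed

lemma prob_measuresI:
  assumes mu: "\<mu> \<in> signed_measures M" and nonneg: "\<And>A. A \<in> sets M \<Longrightarrow> \<mu> A \<ge> 0"
    and one: "\<mu> (space M) = 1"
  shows "\<mu> \<in> prob_measures M"
proof -
  note eq = nonneg_signed_measure_eq_measure[OF mu nonneg]
  interpret finite_measure "pos_part M \<mu>" by (rule finite_measure_pos_part[OF mu])
  have "measure (pos_part M \<mu>) (space (pos_part M \<mu>)) = 1" using one eq by simp
  then have "prob_space (pos_part M \<mu>)"
    by (intro prob_spaceI) (simp add: emeasure_eq_measure)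
  then show ?thesis using eq unfolding prob_measures_def by auto
qed

section \<open>Bounded functionals\<close>

definition bounded_measurable :: "'a measure \<Rightarrow> ('a \<Rightarrow> real) set"
  where "bounded_measurable M = {f \<in> borel_measurable M. bounded (f ` space M)}"

text \<open>Linearity and a sup-norm bound are all that is used of the map from f to its integral,
  and unlike the Jordan parts they are stable under sums, multiples and pullbacks. The bound refers
  to an arbitrary majorant b on \<open>space M\<close>; the case b = 0 shows that values of f off
  \<open>space M\<close> are irrelevant.\<close>

definition bounded_functional :: "'a measure \<Rightarrow> (('a \<Rightarrow> real) \<Rightarrow> real) \<Rightarrow> bool"
  where "bounded_functional M L \<longleftrightarrow>
    (\<forall>f \<in> bounded_measurable M. \<forall>g \<in> bounded_measurable M. L (\<lambda>x. f x + g x) = L f + L g) \<and>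
    (\<forall>f \<in> bounded_measurable M. \<forall>c. L (\<lambda>x. c * f x) = c * L f) \<and>
    (\<exists>C. \<forall>f \<in> bounded_measurable M. \<forall>b\<ge>0. (\<forall>x \<in> space M. \<bar>f x\<bar> \<le> b) \<longrightarrow> \<bar>L f\<bar> \<le> C * b)"

lemma bounded_functionalI:
  assumes "\<And>f g. f \<in> bounded_measurable M \<Longrightarrow> g \<in> bounded_measurable M \<Longrightarrow> L (\<lambda>x. f x + g x) = L f + L g"
    and "\<And>f c. f \<in> bounded_measurable M \<Longrightarrow> L (\<lambda>x. c * f x) = c * L f"
    and "\<And>f b. f \<in> bounded_measurable M \<Longrightarrow> (\<And>x. x \<in> space M \<Longrightarrow> \<bar>f x\<bar> \<le> b) \<Longrightarrow> b \<ge> 0 \<Longrightarrow> \<bar>L f\<bar> \<le> C * b"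
  shows "bounded_functional M L"
  unfolding bounded_functional_def using assms by blast

lemma bounded_measurableI:
  assumes "f \<in> borel_measurable M" "\<And>x. x \<in> space M \<Longrightarrow> \<bar>f x\<bar> \<le> b"
  shows "f \<in> bounded_measurable M"
  using assms unfolding bounded_measurable_def by (auto simp: bounded_iff)

lemma bounded_measurableE:
  assumes "f \<in> bounded_measurable M"
  obtains b where "f \<in> borel_measurable M" "b \<ge> 0" "\<And>x. x \<in> space M \<Longrightarrow> \<bar>f x\<bar> \<le> b"
proof -
  have "bounded (f ` space M)" using assms unfolding bounded_measurable_def by blast
  then obtain b where "b > 0" "\<forall>y \<in> f ` space M. norm y \<le> b" by (auto simp: bounded_pos)
  with assms that[of b] show ?thesis unfolding bounded_measurable_def by auto
qed

lemma bounded_measurable_const: "(\<lambda>_. c) \<in> bounded_measurable M"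
  by (rule bounded_measurableI[of _ _ "\<bar>c\<bar>"]) auto

lemma bounded_measurable_indicator: "A \<in> sets M \<Longrightarrow> indicator A \<in> bounded_measurable M"
  by (rule bounded_measurableI[of _ _ 1]) (auto simp: indicator_def)

lemma bounded_measurable_add:
  assumes "f \<in> bounded_measurable M" "g \<in> bounded_measurable M"
  shows "(\<lambda>x. f x + g x) \<in> bounded_measurable M"
proof -
  from assms(1) obtain a where a: "f \<in> borel_measurable M" "\<And>x. x \<in> space M \<Longrightarrow> \<bar>f x\<bar> \<le> a"
    by (rule bounded_measurableE) blast
  from assms(2) obtain b where b: "g \<in> borel_measurable M" "\<And>x. x \<in> space M \<Longrightarrow> \<bar>g x\<bar> \<le> b"
    by (rule bounded_measurableE) blast
  show ?thesis
  proof (rule bounded_measurableI[of _ _ "a + b"])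
    show "\<bar>f x + g x\<bar> \<le> a + b" if "x \<in> space M" for x
      using a(2)[OF that] b(2)[OF that] by linarith
  qed (use a b in measurable)
qed

lemma bounded_measurable_mult:
  assumes "f \<in> bounded_measurable M" "g \<in> bounded_measurable M"
  shows "(\<lambda>x. f x * g x) \<in> bounded_measurable M"
proof -
  from assms(1) obtain a where a: "f \<in> borel_measurable M" "a \<ge> 0" "\<And>x. x \<in> space M \<Longrightarrow> \<bar>f x\<bar> \<le> a"
    by (rule bounded_measurableE) blast
  from assms(2) obtain b where b: "g \<in> borel_measurable M" "\<And>x. x \<in> space M \<Longrightarrow> \<bar>g x\<bar> \<le> b"
    by (rule bounded_measurableE) blast
  show ?thesis
  proof (rule bounded_measurableI[of _ _ "a * b"])
    show "\<bar>f x * g x\<bar> \<le> a * b" if "x \<in> space M" for x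
      unfolding abs_mult using a(2) a(3)[OF that] b(2)[OF that] by (intro mult_mono) auto
  qed (use a b in measurable)
qed

lemma bounded_measurable_scale:
  "f \<in> bounded_measurable M \<Longrightarrow> (\<lambda>x. c * f x) \<in> bounded_measurable M"
  by (intro bounded_measurable_mult bounded_measurable_const)

lemma bounded_measurable_diff:
  assumes "f \<in> bounded_measurable M" "g \<in> bounded_measurable M"
  shows "(\<lambda>x. f x - g x) \<in> bounded_measurable M"
  using bounded_measurable_add[OF assms(1) bounded_measurable_scale[OF assms(2), of "-1"]] by simp

lemma bounded_measurable_sum:
  assumes "\<And>i. i \<in> I \<Longrightarrow> f i \<in> bounded_measurable M"
  shows "(\<lambda>x. \<Sum>i\<in>I. f i x) \<in> bounded_measurable M"
  using assms by (induction I rule: infinite_finite_induct)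
    (auto intro: bounded_measurable_const bounded_measurable_add)

lemma bounded_measurable_comp:
  assumes "f \<in> bounded_measurable N" "h \<in> M \<rightarrow>\<^sub>M N"
  shows "(\<lambda>x. f (h x)) \<in> bounded_measurable M"
proof -
  from assms(1) obtain a where a: "f \<in> borel_measurable N" "\<And>x. x \<in> space N \<Longrightarrow> \<bar>f x\<bar> \<le> a"
    by (rule bounded_measurableE) blast
  show ?thesis
    using measurable_compose[OF assms(2) a(1)] a(2) measurable_space[OF assms(2)]
    by (intro bounded_measurableI[of _ _ a]) auto
qed

context
  fixes M :: "'a measure" and L :: "('a \<Rightarrow> real) \<Rightarrow> real"
  assumes L: "bounded_functional M L"
begin

lemma functional_add:
  "f \<in> bounded_measurable M \<Longrightarrow> g \<in> bounded_measurable M \<Longrightarrow> L (\<lambda>x. f x + g x) = L f + L g"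
  using L unfolding bounded_functional_def by blast

lemma functional_scale:
  "f \<in> bounded_measurable M \<Longrightarrow> L (\<lambda>x. c * f x) = c * L f"
  using L unfolding bounded_functional_def by blast

lemma functional_diff:
  "f \<in> bounded_measurable M \<Longrightarrow> g \<in> bounded_measurable M \<Longrightarrow> L (\<lambda>x. f x - g x) = L f - L g"
  using functional_add[of f "\<lambda>x. -1 * g x"] functional_scale[of g "-1"] bounded_measurable_scale[of g M "-1"]
  by simp

lemma functional_bound:
  obtains C where "C \<ge> 0"
    "\<And>f b. f \<in> bounded_measurable M \<Longrightarrow> (\<And>x. x \<in> space M \<Longrightarrow> \<bar>f x\<bar> \<le> b) \<Longrightarrow> b \<ge> 0 \<Longrightarrow> \<bar>L f\<bar> \<le> C * b"
proof -
  obtain C where C: "\<forall>f \<in> bounded_measurable M. \<forall>b\<ge>0. (\<forall>x \<in> space M. \<bar>f x\<bar> \<le> b) \<longrightarrow> \<bar>L f\<bar> \<le> C * b"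
    using L unfolding bounded_functional_def by blast
  show ?thesis
  proof (rule that[of "\<bar>C\<bar>"])
    fix f and b :: real
    assume "f \<in> bounded_measurable M" "\<And>x. x \<in> space M \<Longrightarrow> \<bar>f x\<bar> \<le> b" "b \<ge> 0"
    then have "\<bar>L f\<bar> \<le> C * b" using C by blast
    also have "\<dots> \<le> \<bar>C\<bar> * b" using \<open>b \<ge> 0\<close> by (intro mult_right_mono) auto
    finally show "\<bar>L f\<bar> \<le> \<bar>C\<bar> * b" .
  qed simp
qed

lemma functional_cong:
  assumes "f \<in> bounded_measurable M" "g \<in> bounded_measurable M" "\<And>x. x \<in> space M \<Longrightarrow> f x = g x"
  shows "L f = L g"
proof -
  obtain C where C: "\<And>f b. f \<in> bounded_measurable M \<Longrightarrow> (\<And>x. x \<in> space M \<Longrightarrow> \<bar>f x\<bar> \<le> b) \<Longrightarrow> b \<ge> 0 \<Longrightarrow> \<bar>L f\<bar> \<le> C * b"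
    using functional_bound by blast
  have "\<bar>L (\<lambda>x. f x - g x)\<bar> \<le> C * 0"
    using assms by (intro C bounded_measurable_diff) auto
  then show ?thesis using functional_diff assms by simp
qed

lemma functional_sum:
  assumes "\<And>i. i \<in> I \<Longrightarrow> f i \<in> bounded_measurable M"
  shows "L (\<lambda>x. \<Sum>i\<in>I. f i x) = (\<Sum>i\<in>I. L (f i))"
proof -
  have zero: "L (\<lambda>x. 0) = 0"
    using functional_scale[OF bounded_measurable_const[of 0], of 0] by simp
  show ?thesis
    using assms
  proof (induction I rule: infinite_finite_induct)
    case (insert i I)
    have "L (\<lambda>x. f i x + (\<Sum>i\<in>I. f i x)) = L (f i) + L (\<lambda>x. \<Sum>i\<in>I. f i x)"
      using insert by (intro functional_add bounded_measurable_sum) auto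
    then show ?case using insert by simp
  qed (simp_all add: zero)
qed

end

text \<open>Integration against the image under h of the measure with density w. With h =
  \<open>fst\<close>, the weights 1 and \<open>snd\<close> give the two moments of a measure on the
  phase space.\<close>

lemma bounded_functional_pullback:
  assumes L: "bounded_functional N L" and h: "h \<in> N \<rightarrow>\<^sub>M M" and w: "w \<in> bounded_measurable N"
  shows "bounded_functional M (\<lambda>f. L (\<lambda>x. w x * f (h x)))"
proof -
  have bm: "(\<lambda>x. w x * f (h x)) \<in> bounded_measurable N" if "f \<in> bounded_measurable M" for f
    by (intro bounded_measurable_mult[OF w] bounded_measurable_comp[OF that h])
  obtain C where C: "C \<ge> 0" "\<And>f b. f \<in> bounded_measurable N \<Longrightarrow>
      (\<And>x. x \<in> space N \<Longrightarrow> \<bar>f x\<bar> \<le> b) \<Longrightarrow> b \<ge> 0 \<Longrightarrow> \<bar>L f\<bar> \<le> C * b"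
    using functional_bound[OF L] by blast
  from w obtain a where a: "a \<ge> 0" "\<And>x. x \<in> space N \<Longrightarrow> \<bar>w x\<bar> \<le> a"
    by (rule bounded_measurableE) blast
  have "\<bar>L (\<lambda>x. w x * f (h x))\<bar> \<le> (C * a) * b"
    if f: "f \<in> bounded_measurable M" "\<forall>x \<in> space M. \<bar>f x\<bar> \<le> b" and b: "b \<ge> 0" for f b
  proof -
    have "\<bar>L (\<lambda>x. w x * f (h x))\<bar> \<le> C * (a * b)"
    proof (rule C(2)[OF bm[OF f(1)]])
      show "\<bar>w x * f (h x)\<bar> \<le> a * b" if "x \<in> space N" for x
        unfolding abs_mult using a(1) a(2)[OF that] f(2) measurable_space[OF h that]
        by (intro mult_mono) auto
    qed (use a b in simp)
    then show ?thesis by (simp add: mult.assoc)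
  qed
  moreover have "L (\<lambda>x. w x * (f (h x) + g (h x))) = L (\<lambda>x. w x * f (h x)) + L (\<lambda>x. w x * g (h x))"
    if "f \<in> bounded_measurable M" "g \<in> bounded_measurable M" for f g
    using functional_add[OF L bm[OF that(1)] bm[OF that(2)]] by (simp add: distrib_left)
  moreover have "L (\<lambda>x. w x * (c * f (h x))) = c * L (\<lambda>x. w x * f (h x))"
    if "f \<in> bounded_measurable M" for f c
    using functional_scale[OF L bm[OF that(1)], of c] by (simp add: mult.left_commute)
  ultimately show ?thesis unfolding bounded_functional_def by blast
qed

lemma bounded_functional_add:
  assumes "bounded_functional M K" "bounded_functional M L"
  shows "bounded_functional M (\<lambda>f. K f + L f)"
proof -
  obtain C where C: "\<And>f b. f \<in> bounded_measurable M \<Longrightarrow>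
      (\<And>x. x \<in> space M \<Longrightarrow> \<bar>f x\<bar> \<le> b) \<Longrightarrow> b \<ge> 0 \<Longrightarrow> \<bar>K f\<bar> \<le> C * b"
    using functional_bound[OF assms(1)] by blast
  obtain D where D: "\<And>f b. f \<in> bounded_measurable M \<Longrightarrow>
      (\<And>x. x \<in> space M \<Longrightarrow> \<bar>f x\<bar> \<le> b) \<Longrightarrow> b \<ge> 0 \<Longrightarrow> \<bar>L f\<bar> \<le> D * b"
    using functional_bound[OF assms(2)] by blast
  show ?thesis
  proof (rule bounded_functionalI[where C = "C + D"])
    fix f and b :: real
    assume f: "f \<in> bounded_measurable M" "\<And>x. x \<in> space M \<Longrightarrow> \<bar>f x\<bar> \<le> b" "b \<ge> 0"
    show "\<bar>K f + L f\<bar> \<le> (C + D) * b"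
      unfolding distrib_right by (intro order_trans[OF abs_triangle_ineq] add_mono C D f)
  qed (simp_all add: functional_add[OF assms(1)] functional_add[OF assms(2)]
      functional_scale[OF assms(1)] functional_scale[OF assms(2)] distrib_left)
qed

lemma bounded_functional_scale:
  assumes "bounded_functional M L"
  shows "bounded_functional M (\<lambda>f. c * L f)"
proof -
  obtain C where C: "\<And>f b. f \<in> bounded_measurable M \<Longrightarrow>
      (\<And>x. x \<in> space M \<Longrightarrow> \<bar>f x\<bar> \<le> b) \<Longrightarrow> b \<ge> 0 \<Longrightarrow> \<bar>L f\<bar> \<le> C * b"
    using functional_bound[OF assms] by blast
  show ?thesis
  proof (rule bounded_functionalI[where C = "\<bar>c\<bar> * C"])
    fix f and b :: real
    assume f: "f \<in> bounded_measurable M" "\<And>x. x \<in> space M \<Longrightarrow> \<bar>f x\<bar> \<le> b" "b \<ge> 0"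
    show "\<bar>c * L f\<bar> \<le> \<bar>c\<bar> * C * b"
      unfolding abs_mult mult.assoc by (rule mult_left_mono[OF C[OF f]]) auto
  next
    fix f g assume "f \<in> bounded_measurable M" "g \<in> bounded_measurable M"
    then show "c * L (\<lambda>x. f x + g x) = c * L f + c * L g"
      by (simp only: functional_add[OF assms] distrib_left)
  next
    fix f d assume "f \<in> bounded_measurable M"
    then show "c * L (\<lambda>x. d * f x) = d * (c * L f)"
      by (simp only: functional_scale[OF assms] mult.left_commute)
  qed
qed

lemma bounded_functional_diff:
  assumes "bounded_functional M K" "bounded_functional M L"
  shows "bounded_functional M (\<lambda>f. K f - L f)"
  using bounded_functional_add[OF assms(1) bounded_functional_scale[OF assms(2), of "-1"]] by simp

text \<open>The function \<open>f\<close> is uniformly approximated by \<open>\<lambda>x. e * \<lfloor>f x / e\<rfloor>\<close>, which has finite range.\<close>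

lemma functional_eq_zero:
  assumes L: "bounded_functional M L"
    and ind: "\<And>A. A \<in> sets M \<Longrightarrow> L (indicator A) = 0"
    and f: "f \<in> bounded_measurable M"
  shows "L f = 0"
proof -
  obtain C where C: "C \<ge> 0" "\<And>f b. f \<in> bounded_measurable M \<Longrightarrow>
      (\<And>x. x \<in> space M \<Longrightarrow> \<bar>f x\<bar> \<le> b) \<Longrightarrow> b \<ge> 0 \<Longrightarrow> \<bar>L f\<bar> \<le> C * b"
    using functional_bound[OF L] by blast
  from f obtain b where b: "f \<in> borel_measurable M" "b \<ge> 0" "\<And>x. x \<in> space M \<Longrightarrow> \<bar>f x\<bar> \<le> b"
    by (rule bounded_measurableE) blast
  have "\<bar>L f\<bar> \<le> C * e" if "e > 0" for e
  proof -
    \<comment> \<open>By the bound b on f, every value of the floor of f x / e lies in {-n..n}. So g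
      is a finite combination of indicators of level sets, and L vanishes on it.\<close>
    define n where "n = \<lceil>b / e\<rceil> + 1"
    define A where "A k = {x \<in> space M. \<lfloor>f x / e\<rfloor> = k}" for k :: int
    define g where "g x = (\<Sum>k = -n..n. (e * k) * indicator (A k) x)" for x
    have A: "A k \<in> sets M" for k
      unfolding A_def using b(1) by measurable
    have ibm: "indicator (A k) \<in> bounded_measurable M" for k
      by (rule bounded_measurable_indicator[OF A])
    have gbm: "g \<in> bounded_measurable M"
      unfolding g_def by (intro bounded_measurable_sum bounded_measurable_scale ibm)
    have "L g = (\<Sum>k = -n..n. L (\<lambda>x. (e * k) * indicator (A k) x))"
      unfolding g_def by (intro functional_sum[OF L] bounded_measurable_scale ibm)
    also have "\<dots> = 0"
      by (intro sum.neutral ballI) (simp add: functional_scale[OF L ibm] ind[OF A])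
    finally have Lg: "L g = 0" .
    have gx: "g x = e * \<lfloor>f x / e\<rfloor>" if x: "x \<in> space M" for x
    proof -
      have "\<bar>f x / e\<bar> \<le> b / e" using b(3)[OF x] \<open>e > 0\<close> by (simp add: abs_div divide_right_mono)
      then have "f x / e \<le> b / e" "- (b / e) \<le> f x / e" by linarith+
      then have "\<lfloor>f x / e\<rfloor> \<in> {-n..n}" unfolding n_def by (simp add: le_floor_iff floor_le_iff) linarith
      have "g x = (\<Sum>k = -n..n. if k = \<lfloor>f x / e\<rfloor> then e * k else 0)"
        unfolding g_def A_def using x by (intro sum.cong) (auto simp: indicator_def)
      also have "\<dots> = e * \<lfloor>f x / e\<rfloor>" using \<open>\<lfloor>f x / e\<rfloor> \<in> {-n..n}\<close> by simp
      finally show ?thesis .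
    qed
    have "\<bar>L (\<lambda>x. f x - g x)\<bar> \<le> C * e"
    proof (rule C(2)[OF bounded_measurable_diff[OF f gbm]])
      fix x assume x: "x \<in> space M"
      have "0 \<le> f x / e - \<lfloor>f x / e\<rfloor>" "f x / e - \<lfloor>f x / e\<rfloor> \<le> 1" by linarith+
      then have "\<bar>f x / e - \<lfloor>f x / e\<rfloor>\<bar> \<le> 1" by linarith
      then have "\<bar>f x / e - \<lfloor>f x / e\<rfloor>\<bar> * e \<le> 1 * e" using that by (intro mult_right_mono) auto
      also have "\<bar>f x / e - \<lfloor>f x / e\<rfloor>\<bar> * e = \<bar>(f x / e - \<lfloor>f x / e\<rfloor>) * e\<bar>"
        using that by (simp add: abs_mult)
      also have "(f x / e - \<lfloor>f x / e\<rfloor>) * e = f x - g x"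
        using that by (simp add: gx[OF x] field_simps)
      finally show "\<bar>f x - g x\<bar> \<le> e" by simp
    qed (use that in simp)
    then show ?thesis by (simp add: functional_diff[OF L f gbm] Lg)
  qed
  note bound = this
  have "\<bar>L f\<bar> \<le> C * 0"
  proof (rule tendsto_lowerbound)
    show "((\<lambda>e. C * e) \<longlongrightarrow> C * 0) (at_right 0)" by (intro tendsto_intros)
    show "\<forall>\<^sub>F e in at_right 0. \<bar>L f\<bar> \<le> C * e"
      by (rule eventually_mono[OF eventually_at_right_less bound])
  qed simp
  then show ?thesis by simp
qed

lemma bounded_functional_eqI:
  assumes "bounded_functional M K" "bounded_functional M L"
    and "\<And>A. A \<in> sets M \<Longrightarrow> K (indicator A) = L (indicator A)"
    and "f \<in> bounded_measurable M"
  shows "K f = L f"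
  using functional_eq_zero[OF bounded_functional_diff[OF assms(1,2)] _ assms(4)] assms(3) by simp

section \<open>Signed integrals as bounded functionals, and their linearity in the measure\<close>

lemma integrable_bounded_measurable:
  assumes "finite_measure N" "sets N = sets M" "f \<in> bounded_measurable M"
  shows "integrable N f"
proof -
  interpret finite_measure N by fact
  from assms(3) obtain b where "f \<in> borel_measurable M" "\<And>x. x \<in> space M \<Longrightarrow> \<bar>f x\<bar> \<le> b"
    by (rule bounded_measurableE) blast
  then show ?thesis
    using measurable_cong_sets[OF assms(2) refl, of borel] sets_eq_imp_space_eq[OF assms(2)]
    by (intro integrable_const_bound[of _ b]) auto
qed

lemma bounded_functional_integral:
  assumes "finite_measure N" "sets N = sets M"
  shows "bounded_functional M (\<lambda>f. integral\<^sup>L N f)"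
proof (rule bounded_functionalI[where C = "measure N (space N)"])
  interpret finite_measure N by fact
  note int = integrable_bounded_measurable[OF assms]
  show "(\<integral>x. f x + g x \<partial>N) = integral\<^sup>L N f + integral\<^sup>L N g"
    if "f \<in> bounded_measurable M" "g \<in> bounded_measurable M" for f g
    using int[OF that(1)] int[OF that(2)] by (rule Bochner_Integration.integral_add)
  show "(\<integral>x. c * f x \<partial>N) = c * integral\<^sup>L N f" if "f \<in> bounded_measurable M" for f c
    using int[OF that] by (intro Bochner_Integration.integral_mult_right)
  fix f and b :: real
  assume f: "f \<in> bounded_measurable M" "\<And>x. x \<in> space M \<Longrightarrow> \<bar>f x\<bar> \<le> b"
  have "norm (integral\<^sup>L N f) \<le> (\<integral>x. norm (f x) \<partial>N)" by (rule integral_norm_bound)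
  also have "\<dots> \<le> (\<integral>x. b \<partial>N)"
    using f int[OF f(1)] sets_eq_imp_space_eq[OF assms(2)]
    by (intro integral_mono) auto
  finally show "\<bar>integral\<^sup>L N f\<bar> \<le> measure N (space N) * b" by (simp add: mult.commute)
qed

lemma bounded_functional_signed_integral:
  assumes "\<mu> \<in> signed_measures M"
  shows "bounded_functional M (signed_integral M \<mu>)"
  using bounded_functional_diff[OF
      bounded_functional_integral[OF finite_measure_pos_part[OF assms] sets_pos_part]
      bounded_functional_integral[OF finite_measure_neg_part[OF assms] sets_neg_part]]
  by (simp add: signed_integral_def[abs_def])

lemma signed_integral_indicator:
  assumes "\<mu> \<in> signed_measures M" "A \<in> sets M"
  shows "signed_integral M \<mu> (indicator A) = \<mu> A"
  using assms Jordan_decomposition[OF assms] sets.sets_into_space[OF assms(2)]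
  by (simp add: signed_integral_def Int_absorb2)

text \<open>A signed integral is identified by testing on indicators only. This avoids computing the
  Jordan parts of sums, differences and images, for which there is no simple formula.\<close>

lemma signed_integral_eqI:
  assumes "\<mu> \<in> signed_measures M" "bounded_functional M L"
    and "\<And>A. A \<in> sets M \<Longrightarrow> L (indicator A) = \<mu> A" "f \<in> bounded_measurable M"
  shows "signed_integral M \<mu> f = L f"
  by (rule bounded_functional_eqI[OF bounded_functional_signed_integral[OF assms(1)] assms(2) _ assms(4)])
    (simp only: signed_integral_indicator[OF assms(1)] assms(3))

lemma signed_integral_diff_measure:
  assumes "\<mu> \<in> signed_measures M" "\<nu> \<in> signed_measures M" "f \<in> bounded_measurable M"
  shows "signed_integral M (\<lambda>A. \<mu> A - \<nu> A) f = signed_integral M \<mu> f - signed_integral M \<nu> f"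
  by (rule signed_integral_eqI[OF signed_measures_diff[OF assms(1,2)] bounded_functional_diff[OF
      bounded_functional_signed_integral[OF assms(1)] bounded_functional_signed_integral[OF assms(2)]] _ assms(3)])
    (simp only: signed_integral_indicator[OF assms(1)] signed_integral_indicator[OF assms(2)])

lemma signed_integral_add_measure:
  assumes "\<mu> \<in> signed_measures M" "\<nu> \<in> signed_measures M" "f \<in> bounded_measurable M"
  shows "signed_integral M (\<lambda>A. \<mu> A + \<nu> A) f = signed_integral M \<mu> f + signed_integral M \<nu> f"
  by (rule signed_integral_eqI[OF signed_measures_add[OF assms(1,2)] bounded_functional_add[OF
      bounded_functional_signed_integral[OF assms(1)] bounded_functional_signed_integral[OF assms(2)]] _ assms(3)])
    (simp only: signed_integral_indicator[OF assms(1)] signed_integral_indicator[OF assms(2)])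

lemma signed_integral_scale_measure:
  assumes "\<mu> \<in> signed_measures M" "f \<in> bounded_measurable M"
  shows "signed_integral M (\<lambda>A. c * \<mu> A) f = c * signed_integral M \<mu> f"
  by (rule signed_integral_eqI[OF signed_measures_scale[OF assms(1)] bounded_functional_scale[OF
      bounded_functional_signed_integral[OF assms(1)]] _ assms(2)])
    (simp only: signed_integral_indicator[OF assms(1)])

section \<open>Analysis on the torus\<close>

lemma torus_of_surj: "\<exists>a. x = torus_of a"
proof -
  have "\<forall>x. \<exists>a. x = torus_of a"
    by transfer (metis Ints_0 diff_self)
  then show ?thesis by blast
qed

lemma torus_of_frac: "torus_of (frac a) = torus_of a"
  unfolding torus_of_eq_iff by (simp add: frac_def)

lemma torus_of_add: "torus_of (a + b) = torus_of a + torus_of b"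
  by transfer simp

lemma torus_of_0 [simp]: "torus_of 0 = 0"
  by transfer simp

lemma continuous_on_torus_of: "continuous_on S torus_of"
proof -
  have "continuous_on UNIV torus_of"
    unfolding continuous_on_open_vimage[OF open_UNIV] by (auto simp: open_torus_def)
  then show ?thesis using continuous_on_subset by blast
qed

text \<open>The universal property of the quotient: a set is open in the torus exactly if its
  preimage in the line is.\<close>

lemma continuous_on_torusI:
  assumes "continuous_on UNIV (\<lambda>a. f (torus_of a))"
  shows "continuous_on UNIV f"
  unfolding continuous_on_open_vimage[OF open_UNIV]
proof (intro allI impI)
  fix B :: "'a set" assume "open B"
  then have "open ((\<lambda>a. f (torus_of a)) -` B \<inter> UNIV)"
    using assms unfolding continuous_on_open_vimage[OF open_UNIV] by blast
  then show "open (f -` B \<inter> UNIV)" by (simp add: open_torus_def vimage_def)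
qed

lemma compact_torus: "compact (UNIV :: torus set)"
proof -
  have "x \<in> torus_of ` {0..1}" for x
    using torus_of_surj[of x] torus_of_frac frac_ge_0 frac_lt_1
    by (metis atLeastAtMost_iff imageI less_imp_le)
  then have "torus_of ` {0..1} = UNIV" by blast
  moreover have "compact (torus_of ` {0..1})"
    by (intro compact_continuous_image continuous_on_torus_of) simp
  ultimately show ?thesis by simp
qed

lemma continuous_on_torus_translate: "continuous_on UNIV (\<lambda>y :: torus. x + y)"
proof (rule continuous_on_torusI)
  obtain a where "x = torus_of a" using torus_of_surj by blast
  then have eq: "(\<lambda>b. x + torus_of b) = (\<lambda>b. torus_of (a + b))" by (simp add: torus_of_add)
  show "continuous_on UNIV (\<lambda>b. x + torus_of b)"
    unfolding eq
    by (intro continuous_on_compose2[OF continuous_on_torus_of[of UNIV]] continuous_intros) auto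
qed

text \<open>The basic character of the torus. It is an injective continuous homomorphism, and serves
  three ends: its real and imaginary parts are test functions with addition formulas, it separates
  points, and it transports Borel measures to the complex plane.\<close>

lift_definition circ :: "torus \<Rightarrow> complex" is "\<lambda>x. cis (2 * pi * x)"
proof -
  fix x y :: real
  assume "x - y \<in> \<int>"
  then have "cis (2 * pi * (x - y)) = 1" by (auto elim!: Ints_cases simp: cis_multiple_2pi)
  then show "cis (2 * pi * x) = cis (2 * pi * y)"
    by (simp add: right_diff_distrib flip: cis_divide)
qed

lemma circ_torus_of: "circ (torus_of x) = cis (2 * pi * x)"
  by transfer simp

lemma circ_add: "circ (x + y) = circ x * circ y"
  by transfer (simp add: cis_mult distrib_left)

lemma inj_circ: "inj circ"
proof (rule injI)
  fix x y :: torus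
  obtain a b where ab: "x = torus_of a" "y = torus_of b" using torus_of_surj by metis
  assume "circ x = circ y"
  then have "cis (2 * pi * (a - b)) = 1"
    unfolding ab circ_torus_of by (simp add: right_diff_distrib flip: cis_divide)
  then have "cos (2 * pi * (a - b)) = 1" by (simp add: complex_eq_iff)
  then obtain n :: int where "2 * pi * (a - b) = real_of_int n * 2 * pi"
    unfolding cos_one_2pi_int by blast
  then have "a - b = real_of_int n" by simp
  then show "x = y" unfolding ab torus_of_eq_iff by simp
qed

lemma continuous_on_circ: "continuous_on S circ"
proof -
  have "continuous_on UNIV circ"
    by (rule continuous_on_torusI) (simp add: circ_torus_of, intro continuous_intros)
  then show ?thesis using continuous_on_subset by blast
qed

text \<open>Disjoint neighbourhoods in the plane are pulled back along \<open>circ\<close>. The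
  Hausdorff property is part of the setting of the Stone--Weierstrass theorem.\<close>

instance torus :: t2_space
proof
  fix x y :: torus
  assume "x \<noteq> y"
  then have "circ x \<noteq> circ y" using inj_circ by (simp add: inj_eq)
  then obtain U V where "open U" "open V" "circ x \<in> U" "circ y \<in> V" "U \<inter> V = {}"
    using hausdorff by metis
  moreover have "open (circ -` U)" "open (circ -` V)"
    using calculation continuous_on_circ[of UNIV] by (simp_all add: continuous_on_open_vimage[OF open_UNIV])
  ultimately show "\<exists>U V. open U \<and> open V \<and> x \<in> U \<and> y \<in> V \<and> U \<inter> V = {}"
    by (intro exI[of _ "circ -` U"] exI[of _ "circ -` V"]) auto
qed

lemma bounded_measurable_continuous:
  fixes f :: "torus \<Rightarrow> real"
  assumes "continuous_on UNIV f"
  shows "f \<in> bounded_measurable borel"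
  unfolding bounded_measurable_def
  using assms compact_imp_bounded[OF compact_continuous_image[OF assms compact_torus]]
  by (simp add: borel_measurable_continuous_onI)

section \<open>Calculus of continuously differentiable functions on the torus\<close>

lemma C1_has_derivative:
  assumes "f \<in> C1"
  shows "((\<lambda>h. f (x + torus_of h)) has_real_derivative dx f x) (at 0)"
proof -
  have "(\<lambda>h. f (x + torus_of h)) differentiable (at 0)" using assms unfolding C1_def by blast
  then show ?thesis unfolding dx_def
    by (simp add: DERIV_deriv_iff_real_differentiable)
qed

lemma C1I:
  assumes "\<And>x. ((\<lambda>h. f (x + torus_of h)) has_real_derivative f' x) (at 0)" "continuous_on UNIV f'"
  shows "f \<in> C1" "dx f = f'"
proof -
  show *: "dx f = f'"
    unfolding dx_def[abs_def] using DERIV_imp_deriv[OF assms(1)] by auto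
  show "f \<in> C1"
    using assms by (auto simp: C1_def * real_differentiable_def)
qed

lemma continuous_on_dx: "f \<in> C1 \<Longrightarrow> continuous_on UNIV (dx f)"
  unfolding C1_def by blast

text \<open>Differentiability along translations gives continuity on the line at each point, after
  shifting the base point by the group law; the quotient property does the rest.\<close>

lemma continuous_on_C1:
  assumes "f \<in> C1"
  shows "continuous_on UNIV f"
proof (rule continuous_on_torusI)
  have "isCont (\<lambda>a. f (torus_of a)) b" for b
  proof -
    have "isCont (\<lambda>h. f (torus_of b + torus_of h)) 0"
      using C1_has_derivative[OF assms] by (rule DERIV_isCont)
    then have "isCont (\<lambda>h. f (torus_of (b + h))) 0" by (simp add: torus_of_add)
    then have "isCont (\<lambda>a. f (torus_of (b + (a - b)))) b"
      by (intro isCont_o2[of b "\<lambda>a. a - b" "\<lambda>h. f (torus_of (b + h))"] continuous_intros) simp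
    then show ?thesis by simp
  qed
  then show "continuous_on UNIV (\<lambda>a. f (torus_of a))"
    by (simp add: continuous_at_imp_continuous_on)
qed

lemma C1_const: "(\<lambda>_. c) \<in> C1"
  by (rule C1I[of _ "\<lambda>_. 0"]) auto

lemma C1_add:
  assumes "f \<in> C1" "g \<in> C1"
  shows "(\<lambda>x. f x + g x) \<in> C1" "dx (\<lambda>x. f x + g x) = (\<lambda>x. dx f x + dx g x)"
  by (rule C1I[of _ "\<lambda>x. dx f x + dx g x"],
      intro DERIV_add C1_has_derivative assms, intro continuous_on_add continuous_on_dx assms)+

lemma C1_scale:
  assumes "f \<in> C1"
  shows "(\<lambda>x. c * f x) \<in> C1" "dx (\<lambda>x. c * f x) = (\<lambda>x. c * dx f x)"
  by (rule C1I[of _ "\<lambda>x. c * dx f x"], intro DERIV_cmult C1_has_derivative assms,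
      intro continuous_on_mult continuous_on_const continuous_on_dx assms)+

lemma C1_mult:
  assumes "f \<in> C1" "g \<in> C1"
  shows "(\<lambda>x. f x * g x) \<in> C1"
proof (rule C1I)
  show "((\<lambda>h. f (x + torus_of h) * g (x + torus_of h)) has_real_derivative dx f x * g x + dx g x * f x) (at 0)" for x
    using DERIV_mult[OF C1_has_derivative[OF assms(1)] C1_has_derivative[OF assms(2)]] by simp
  show "continuous_on UNIV (\<lambda>x. dx f x * g x + dx g x * f x)"
    by (intro continuous_intros continuous_on_dx continuous_on_C1 assms)
qed

lemma C1_Re_circ: "(\<lambda>x. Re (circ x)) \<in> C1"
proof (rule C1I)
  fix x
  have "(\<lambda>h. Re (circ (x + torus_of h))) = (\<lambda>h. Re (circ x) * cos (2 * pi * h) - Im (circ x) * sin (2 * pi * h))"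
    by (simp add: circ_add circ_torus_of)
  moreover have "((\<lambda>h. Re (circ x) * cos (2 * pi * h) - Im (circ x) * sin (2 * pi * h))
    has_real_derivative - 2 * pi * Im (circ x)) (at 0)"
    by (auto intro!: derivative_eq_intros)
  ultimately show "((\<lambda>h. Re (circ (x + torus_of h))) has_real_derivative - 2 * pi * Im (circ x)) (at 0)"
    by simp
qed (intro continuous_intros continuous_on_circ)

lemma C1_Im_circ: "(\<lambda>x. Im (circ x)) \<in> C1"
proof (rule C1I)
  fix x
  have "(\<lambda>h. Im (circ (x + torus_of h))) = (\<lambda>h. Re (circ x) * sin (2 * pi * h) + Im (circ x) * cos (2 * pi * h))"
    by (simp add: circ_add circ_torus_of)
  moreover have "((\<lambda>h. Re (circ x) * sin (2 * pi * h) + Im (circ x) * cos (2 * pi * h))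
    has_real_derivative 2 * pi * Re (circ x)) (at 0)"
    by (auto intro!: derivative_eq_intros)
  ultimately show "((\<lambda>h. Im (circ (x + torus_of h))) has_real_derivative 2 * pi * Re (circ x)) (at 0)"
    by simp
qed (intro continuous_intros continuous_on_circ)

section \<open>Separable functions\<close>

text \<open>Functions whose translates lie in a finite-dimensional space; trigonometric polynomials
  are the model. Both factors are required to be \<open>C1\<close>: the derivative in x falls on
  \<open>a i\<close>, while the weak equations need \<open>b i\<close> as test function. The index
  set consists of naturals because an existential quantifier cannot range over index types.\<close>

definition separable :: "(torus \<Rightarrow> real) set"
  where "separable = {f. \<exists>(I :: nat set) a b. finite I \<and> (\<forall>i\<in>I. a i \<in> C1 \<and> b i \<in> C1) \<and>
    (\<forall>x y. f (x + y) = (\<Sum>i\<in>I. a i x * b i y))}"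

text \<open>For y = 0 the expansion writes f as a linear combination of the functions
  \<open>a i\<close>.\<close>

lemma separable_C1:
  assumes "f \<in> separable"
  shows "f \<in> C1"
proof -
  obtain I :: "nat set" and a b where I: "finite I" "\<And>i. i \<in> I \<Longrightarrow> a i \<in> C1 \<and> b i \<in> C1"
    "\<And>x y. f (x + y) = (\<Sum>i\<in>I. a i x * b i y)"
    using assms unfolding separable_def by blast
  have "f = (\<lambda>x. \<Sum>i\<in>I. b i 0 * a i x)"
    using I(3)[of _ 0] by (simp add: mult.commute fun_eq_iff)
  moreover have "(\<lambda>x. \<Sum>i\<in>J. b i 0 * a i x) \<in> C1" if "finite J" "J \<subseteq> I" for J
    using that
  proof (induction J rule: finite_induct)
    case (insert j J)
    then have "a j \<in> C1" "(\<lambda>x. \<Sum>i\<in>J. b i 0 * a i x) \<in> C1" using I(2) by auto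
    then have "(\<lambda>x. b j 0 * a j x + (\<Sum>i\<in>J. b i 0 * a i x)) \<in> C1"
      by (intro C1_add(1) C1_scale(1))
    then show ?case using insert by simp
  qed (simp add: C1_const)
  ultimately show ?thesis using I(1) by auto
qed

lemma separable_const: "(\<lambda>_. c) \<in> separable"
  unfolding separable_def mem_Collect_eq
  by (intro exI[of _ "{0}"] exI[of _ "\<lambda>_ _. c"] exI[of _ "\<lambda>_ _. 1"]) (simp add: C1_const)

text \<open>The two expansions are indexed by the disjoint union of I and J, which
  \<open>sum_encode\<close> carries back into the naturals. Products use pairs of indices and
  \<open>prod_encode\<close> in the same way.\<close>

lemma separable_add:
  assumes "f \<in> separable" "g \<in> separable"
  shows "(\<lambda>x. f x + g x) \<in> separable"
proof -
  obtain I :: "nat set" and a b where I: "finite I" "\<forall>i\<in>I. a i \<in> C1 \<and> b i \<in> C1"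
    "\<forall>x y. f (x + y) = (\<Sum>i\<in>I. a i x * b i y)"
    using assms(1) unfolding separable_def by auto
  obtain J :: "nat set" and c d where J: "finite J" "\<forall>i\<in>J. c i \<in> C1 \<and> d i \<in> C1"
    "\<forall>x y. g (x + y) = (\<Sum>i\<in>J. c i x * d i y)"
    using assms(2) unfolding separable_def by auto
  have "(\<Sum>i\<in>sum_encode ` (I <+> J). case_sum a c (sum_decode i) x * case_sum b d (sum_decode i) y)
    = (\<Sum>i\<in>I. a i x * b i y) + (\<Sum>i\<in>J. c i x * d i y)" for x y
    using I(1) J(1) by (simp add: sum.reindex inj_sum_encode sum.Plus)
  then show ?thesis
    unfolding separable_def mem_Collect_eq using I J
    by (intro exI[of _ "sum_encode ` (I <+> J)"] exI[of _ "\<lambda>i. case_sum a c (sum_decode i)"]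
        exI[of _ "\<lambda>i. case_sum b d (sum_decode i)"]) auto
qed

lemma separable_mult:
  assumes "f \<in> separable" "g \<in> separable"
  shows "(\<lambda>x. f x * g x) \<in> separable"
proof -
  obtain I :: "nat set" and a b where I: "finite I" "\<forall>i\<in>I. a i \<in> C1 \<and> b i \<in> C1"
    "\<forall>x y. f (x + y) = (\<Sum>i\<in>I. a i x * b i y)"
    using assms(1) unfolding separable_def by auto
  obtain J :: "nat set" and c d where J: "finite J" "\<forall>i\<in>J. c i \<in> C1 \<and> d i \<in> C1"
    "\<forall>x y. g (x + y) = (\<Sum>i\<in>J. c i x * d i y)"
    using assms(2) unfolding separable_def by auto
  define A where "A k = (\<lambda>(i, j) x. a i x * c j x) (prod_decode k)" for k
  define B where "B k = (\<lambda>(i, j) x. b i x * d j x) (prod_decode k)" for k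
  have "(\<Sum>k\<in>prod_encode ` (I \<times> J). A k x * B k y)
    = (\<Sum>i\<in>I. a i x * b i y) * (\<Sum>j\<in>J. c j x * d j y)" for x y
    using I(1) J(1) by (simp add: A_def B_def sum.reindex inj_prod_encode sum_product
        sum.cartesian_product case_prod_unfold mult_ac)
  then show ?thesis
    unfolding separable_def mem_Collect_eq using I J
    by (intro exI[of _ "prod_encode ` (I \<times> J)"] exI[of _ A] exI[of _ B])
      (auto simp: A_def B_def intro!: C1_mult)
qed

text \<open>The addition formula of the cosine, with two terms; the minus sign is put into the first
  factor.\<close>

lemma separable_Re_circ: "(\<lambda>x. Re (circ x)) \<in> separable"
  using C1_scale(1)[OF C1_Im_circ, of "-1"]
  unfolding separable_def mem_Collect_eq
  by (intro exI[of _ "{0, 1}"] exI[of _ "\<lambda>i x. if i = 0 then Re (circ x) else - Im (circ x)"]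
      exI[of _ "\<lambda>i x. if i = 0 then Re (circ x) else Im (circ x)"])
    (auto simp: circ_add C1_Re_circ C1_Im_circ)

lemma separable_Im_circ: "(\<lambda>x. Im (circ x)) \<in> separable"
  unfolding separable_def mem_Collect_eq
  by (intro exI[of _ "{0, 1}"] exI[of _ "\<lambda>i x. if i = 0 then Re (circ x) else Im (circ x)"]
      exI[of _ "\<lambda>i x. if i = 0 then Im (circ x) else Re (circ x)"])
    (auto simp: circ_add C1_Re_circ C1_Im_circ)

lemma separable_dense:
  assumes "continuous_on UNIV f" "e > 0"
  obtains g where "g \<in> separable" "\<And>x. \<bar>f x - g x\<bar> < e"
proof -
  \<comment> \<open>Points are separated because \<open>circ\<close> is injective: two distinct
    points differ in the real or in the imaginary part of their images.\<close>
  interpret function_ring_on separable "UNIV :: torus set"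
  proof
    fix x y :: torus
    assume "x \<noteq> y"
    then have "circ x \<noteq> circ y" using inj_circ by (simp add: inj_eq)
    then show "\<exists>f\<in>separable. f x \<noteq> f y"
      using separable_Re_circ separable_Im_circ by (metis complex_eqI)
  qed (auto intro: compact_torus continuous_on_C1 separable_C1 separable_add separable_mult separable_const)
  show ?thesis using Stone_Weierstrass_basic[OF assms] that by blast
qed

section \<open>Positivity of signed measures on the torus\<close>

text \<open>It suffices to treat open U. Its complement is compact, so the image of the complement
  is closed in the plane, and by injectivity U is the preimage of the complement of that image. Thus
  measures on the torus lose no Borel set when mapped to the plane.\<close>

lemma borel_torus_vimage_circ:
  assumes "A \<in> sets (borel :: torus measure)"
  shows "\<exists>B \<in> sets borel. A = circ -` B"
proof -
  have "U \<in> sets (vimage_algebra UNIV circ borel)" if "open U" for U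
  proof -
    have "compact (- U)"
      using compact_Int_closed[OF compact_torus, of "- U"] that by (simp add: closed_def)
    then have "compact (circ ` (- U))" by (intro compact_continuous_image continuous_on_circ)
    then have "open (- circ ` (- U))" by (simp add: compact_imp_closed open_Compl)
    moreover have "circ -` (- circ ` (- U)) = U" using inj_circ by (auto simp: inj_def)
    ultimately show ?thesis by (auto simp: sets_vimage_algebra2 intro!: exI[of _ "- circ ` (- U)"])
  qed
  then have "sigma_sets UNIV {U :: torus set. open U} \<subseteq> sets (vimage_algebra UNIV circ borel)"
    by (metis (no_types, lifting) mem_Collect_eq sets.sigma_sets_subset space_vimage_algebra subsetI)
  then have "A \<in> sets (vimage_algebra UNIV circ borel)"
    using assms unfolding borel_def by auto
  then show ?thesis by (auto simp: sets_vimage_algebra2)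
qed

lemma circ_measurable: "circ \<in> borel \<rightarrow>\<^sub>M borel"
  by (intro borel_measurable_continuous_onI continuous_on_circ)

text \<open>Positivity spreads from separable functions to continuous ones by density, then to the
  inequality of the two Jordan parts on compact sets by approximating their indicators, and finally
  to Borel sets by inner regularity. The last two stages take place in the complex plane, where
  metric and regularity are at hand.\<close>

lemma signed_measure_nonneg:
  assumes mu: "\<mu> \<in> signed_measures borel"
    and sep: "\<And>f. f \<in> separable \<Longrightarrow> (\<And>x. f x \<ge> 0) \<Longrightarrow> signed_integral borel \<mu> f \<ge> 0"
    and A: "A \<in> sets borel"
  shows "\<mu> A \<ge> 0"
proof -
  let ?L = "signed_integral borel \<mu>" and ?p = "pos_part borel \<mu>" and ?n = "neg_part borel \<mu>"
  note L = bounded_functional_signed_integral[OF mu]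
  interpret p: finite_measure ?p by (rule finite_measure_pos_part[OF mu])
  interpret n: finite_measure ?n by (rule finite_measure_neg_part[OF mu])
  obtain C where C: "C \<ge> 0" "\<And>f b. f \<in> bounded_measurable borel \<Longrightarrow>
      (\<And>x. x \<in> space borel \<Longrightarrow> \<bar>f x\<bar> \<le> b) \<Longrightarrow> b \<ge> 0 \<Longrightarrow> \<bar>?L f\<bar> \<le> C * b"
    using functional_bound[OF L] by blast
  have cont: "?L f \<ge> 0" if f: "continuous_on UNIV f" "\<And>x. f x \<ge> 0" for f
  proof -
    have bound: "- ?L f \<le> C * (2 * e)" if "e > 0" for e
    proof -
      \<comment> \<open>Approximating f + e up to e, instead of f, keeps the approximant g
        nonnegative, so that the hypothesis applies to g. The distance from g to f is then at most 2
        e.\<close>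
      have "continuous_on UNIV (\<lambda>x. f x + e)" by (intro continuous_intros f)
      then obtain g where g: "g \<in> separable" "\<And>x. \<bar>(f x + e) - g x\<bar> < e"
        using separable_dense \<open>e > 0\<close> by metis
      have gx: "g x \<ge> 0 \<and> \<bar>g x - f x\<bar> \<le> 2 * e" for x using g(2)[of x] f(2)[of x] by linarith
      have bm: "f \<in> bounded_measurable borel" "g \<in> bounded_measurable borel"
        using f g by (auto intro: bounded_measurable_continuous continuous_on_C1 separable_C1)
      have "\<bar>?L (\<lambda>x. g x - f x)\<bar> \<le> C * (2 * e)"
        using gx that by (intro C(2) bounded_measurable_diff bm) auto
      moreover have "?L g \<ge> 0" using gx by (intro sep g) auto
      ultimately show ?thesis using functional_diff[OF L bm(2,1)] by linarith
    qed
    have "- ?L f \<le> C * (2 * 0)"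
    proof (rule tendsto_lowerbound)
      show "((\<lambda>e. C * (2 * e)) \<longlongrightarrow> C * (2 * 0)) (at_right 0)" by (intro tendsto_intros)
      show "\<forall>\<^sub>F e in at_right 0. - ?L f \<le> C * (2 * e)"
        by (rule eventually_mono[OF eventually_at_right_less bound])
    qed simp
    then show ?thesis by simp
  qed
  define P where "P = distr ?p borel circ"
  define N where "N = distr ?n borel circ"
  have circp: "circ \<in> ?p \<rightarrow>\<^sub>M borel" and circn: "circ \<in> ?n \<rightarrow>\<^sub>M borel"
    using circ_measurable by (simp_all cong: measurable_cong_sets)
  interpret P: finite_measure P unfolding P_def by (rule p.finite_measure_distr[OF circp])
  interpret N: finite_measure N unfolding N_def by (rule n.finite_measure_distr[OF circn])
  have compact_le: "emeasure N K \<le> emeasure P K" if K: "compact K" for K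
  proof (cases "K = {}")
    case False
    have "closed K" using K by (rule compact_imp_closed)
    \<comment> \<open>These continuous functions decrease to the indicator of K, because the
      distance to the closed set K is positive outside K. The empty set is treated apart: its
      \<open>infdist\<close> is 0 by convention, and f k would be constantly 1.\<close>
    define f where "f k z = max 0 (1 - real k * infdist z K)" for k z
    have fc: "continuous_on UNIV (\<lambda>x. f k (circ x))" for k
      unfolding f_def by (intro continuous_intros continuous_on_circ)
    have f_lim: "(\<lambda>k. f k z) \<longlonglongrightarrow> indicator K z" for z
    proof (cases "z \<in> K")
      case True
      then show ?thesis by (simp add: f_def)
    next
      case False
      then have "infdist z K > 0"
        using \<open>closed K\<close> \<open>K \<noteq> {}\<close> by (metis in_closed_iff_infdist_zero infdist_nonneg less_eq_real_def)
      then obtain m where m: "1 < real m * infdist z K" using reals_Archimedean3 by blast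
      have "f k z = 0" if "k \<ge> m" for k
      proof -
        have "real m * infdist z K \<le> real k * infdist z K"
          using that by (intro mult_right_mono infdist_nonneg) auto
        then show ?thesis unfolding f_def using m by simp
      qed
      then have "\<forall>\<^sub>F k in sequentially. f k z = indicator K z"
        using False unfolding eventually_sequentially by auto
      then show ?thesis by (rule tendsto_eventually)
    qed
    have f01: "\<bar>f k z\<bar> \<le> 1" for k z
      unfolding f_def using infdist_nonneg[of z K] by (simp add: max_def)
    have lim: "(\<lambda>k. integral\<^sup>L R (f k)) \<longlonglongrightarrow> measure R K"
      if R: "finite_measure R" "sets R = sets borel" for R :: "complex measure"
    proof -
      interpret R: finite_measure R by fact
      have "(\<lambda>k. integral\<^sup>L R (f k)) \<longlonglongrightarrow> integral\<^sup>L R (indicator K)"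
      proof (rule integral_dominated_convergence[where w = "\<lambda>_. 1"])
        show "f k \<in> borel_measurable R" for k
          unfolding f_def measurable_cong_sets[OF R(2) refl]
          by (intro borel_measurable_continuous_onI continuous_intros)
        show "indicator K \<in> borel_measurable R"
          unfolding measurable_cong_sets[OF R(2) refl]
          using \<open>closed K\<close> by (intro borel_measurable_indicator) simp
      qed (use f_lim f01 in auto)
      then show ?thesis using \<open>closed K\<close> R(2) sets_eq_imp_space_eq[OF R(2)] by simp
    qed
    have "integral\<^sup>L N (f k) \<le> integral\<^sup>L P (f k)" for k
    proof -
      have fm: "f k \<in> borel_measurable borel"
        unfolding f_def by (intro borel_measurable_continuous_onI continuous_intros)
      have "0 \<le> ?L (\<lambda>x. f k (circ x))" by (rule cont[OF fc]) (simp add: f_def)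
      then show ?thesis
        unfolding signed_integral_def P_def N_def
        by (simp add: integral_distr[OF circp fm] integral_distr[OF circn fm])
    qed
    moreover have "(\<lambda>k. integral\<^sup>L N (f k)) \<longlonglongrightarrow> measure N K"
      by (rule lim[OF N.finite_measure_axioms]) (simp add: N_def)
    moreover have "(\<lambda>k. integral\<^sup>L P (f k)) \<longlonglongrightarrow> measure P K"
      by (rule lim[OF P.finite_measure_axioms]) (simp add: P_def)
    ultimately have "measure N K \<le> measure P K" by (blast intro: LIMSEQ_le)
    then show ?thesis by (simp add: N.emeasure_eq_measure P.emeasure_eq_measure)
  qed simp
  obtain B where B: "B \<in> sets borel" "A = circ -` B" using borel_torus_vimage_circ[OF A] by blast
  \<comment> \<open>Both measures are finite Borel measures on a complete separable space, so their
    values at B are suprema over the same compact subsets, which are compared term by term.\<close>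
  have "emeasure N B = (SUP K \<in> {K. K \<subseteq> B \<and> compact K}. emeasure N K)"
    by (rule inner_regular[OF _ _ B(1)]) (simp_all add: N_def N.emeasure_finite[unfolded N_def])
  also have "\<dots> \<le> (SUP K \<in> {K. K \<subseteq> B \<and> compact K}. emeasure P K)"
    using compact_le by (intro SUP_mono) blast
  also have "\<dots> = emeasure P B"
    by (rule inner_regular[OF _ _ B(1), symmetric]) (simp_all add: P_def P.emeasure_finite[unfolded P_def])
  finally have "measure N B \<le> measure P B"
    by (simp add: N.emeasure_eq_measure P.emeasure_eq_measure)
  then have "measure ?n A \<le> measure ?p A"
    using B(1) circp circn unfolding B(2) N_def P_def by (simp add: measure_distr)
  then show ?thesis using Jordan_decomposition[OF mu A] by simp
qed

section \<open>A minimum principle\<close>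

text \<open>Only times before t enter: there the numerator f s - f t is nonnegative and the
  denominator s - t is nonpositive. Working from the left covers the final time t = T as
  well.\<close>

lemma left_minimum_derivative_le_0:
  fixes f :: "real \<Rightarrow> real"
  assumes der: "(f has_real_derivative D) (at t within {0..T})" and t: "0 < t" "t \<le> T"
    and min: "\<And>s. 0 \<le> s \<Longrightarrow> s \<le> t \<Longrightarrow> f t \<le> f s"
  shows "D \<le> 0"
proof -
  have "(f has_real_derivative D) (at t within {0..t})"
    by (rule has_field_derivative_subset[OF der]) (use t in auto)
  then have lim: "((\<lambda>s. (f s - f t) / (s - t)) \<longlongrightarrow> D) (at t within {0..t})"
    by (simp add: has_field_derivative_iff)
  show ?thesis
  proof (rule tendsto_upperbound[OF lim])
    show "\<forall>\<^sub>F s in at t within {0..t}. (f s - f t) / (s - t) \<le> 0"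
      unfolding eventually_at_filter using min
      by (intro always_eventually allI impI divide_nonneg_nonpos) auto
    show "at t within {0..t} \<noteq> bot"
      using t by (simp add: at_within_Icc_at_left)
  qed
qed

text \<open>The contradiction for the component that attains the minimum, stated once for both
  speeds. The torus has no boundary, so the spatial derivative D vanishes at the minimum whatever
  the speed c; the summand e comes from adding e t to the solution.\<close>

lemma transport_no_interior_minimum:
  fixes u w :: "real \<Rightarrow> torus \<Rightarrow> real"
  assumes t: "0 < t" "t \<le> T" and "lam \<ge> 0" "e > 0"
    and dt: "((\<lambda>s. u s x) has_real_derivative c * D + lam * (w t x - u t x) + e) (at t within {0..T})"
    and dh: "((\<lambda>h. u t (x + torus_of h)) has_real_derivative D) (at 0)"
    and min: "\<And>s y. 0 \<le> s \<Longrightarrow> s \<le> t \<Longrightarrow> u t x \<le> u s y" and le: "u t x \<le> w t x"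
  shows False
proof -
  have "D = 0"
    by (rule DERIV_local_min[OF dh, of 1]) (use min t in auto)
  moreover have "c * D + lam * (w t x - u t x) + e \<le> 0"
    by (rule left_minimum_derivative_le_0[OF dt t]) (rule min)
  moreover have "lam * (w t x - u t x) \<ge> 0" using assms by simp
  ultimately show False using \<open>e > 0\<close> by simp
qed

text \<open>At a negative minimum of \<open>min (u + e t) (w + e t)\<close> over \<open>[0,T] \<times> \<T>\<close> the transport term
  vanishes and the exchange term has the good sign, so the time derivative would be at
  least \<open>e > 0\<close>.\<close>

lemma transport_minimum_principle:
  fixes u w ux wx :: "real \<Rightarrow> torus \<Rightarrow> real"
  assumes "lam \<ge> 0"
    and cont: "continuous_on ({0..T} \<times> UNIV) (\<lambda>p. u (fst p) (snd p))"
      "continuous_on ({0..T} \<times> UNIV) (\<lambda>p. w (fst p) (snd p))"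
    and du: "\<And>t x. t \<in> {0..T} \<Longrightarrow>
      ((\<lambda>s. u s x) has_real_derivative c * ux t x + lam * (w t x - u t x)) (at t within {0..T})"
    and dw: "\<And>t x. t \<in> {0..T} \<Longrightarrow>
      ((\<lambda>s. w s x) has_real_derivative d * wx t x + lam * (u t x - w t x)) (at t within {0..T})"
    and dux: "\<And>t x. t \<in> {0..T} \<Longrightarrow> ((\<lambda>h. u t (x + torus_of h)) has_real_derivative ux t x) (at 0)"
    and dwx: "\<And>t x. t \<in> {0..T} \<Longrightarrow> ((\<lambda>h. w t (x + torus_of h)) has_real_derivative wx t x) (at 0)"
    and init: "\<And>x. u 0 x \<ge> 0" "\<And>x. w 0 x \<ge> 0"
    and t: "t \<in> {0..T}"
  shows "u t x \<ge> 0 \<and> w t x \<ge> 0"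
proof -
  have main: "u t x + e * t \<ge> 0 \<and> w t x + e * t \<ge> 0" if e: "e > 0" and t: "t \<in> {0..T}" for e t x
  proof -
    \<comment> \<open>The minimum is taken jointly over both components, so that at a minimizer the
      smaller component is also below the other one and the exchange term is nonnegative.\<close>
    define m where "m p = min (u (fst p) (snd p)) (w (fst p) (snd p)) + e * fst p" for p
    have "continuous_on ({0..T} \<times> UNIV) m"
      unfolding m_def by (intro continuous_intros cont)
    moreover have "compact ({0..T} \<times> (UNIV :: torus set))"
      by (intro compact_Times compact_torus) simp
    moreover have "{0..T} \<times> (UNIV :: torus set) \<noteq> {}" using t by auto
    ultimately obtain p where p: "p \<in> {0..T} \<times> UNIV" "\<forall>q \<in> {0..T} \<times> UNIV. m p \<le> m q"
      using continuous_attains_inf by blast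
    obtain s y where sy: "p = (s, y)" by (cases p)
    have s: "0 \<le> s" "s \<le> T" using p sy by auto
    have mle: "m p \<le> m (r, z)" if "0 \<le> r" "r \<le> T" for r z using p(2) that by auto
    have "s = 0"
    proof (rule ccontr)
      assume "s \<noteq> 0"
      then have "s > 0" using s by simp
      show False
      \<comment> \<open>The component realizing the minimum at (s, y) takes the role of u in
        \<open>transport_no_interior_minimum\<close>, the other one that of w.\<close>
      proof (cases "u s y \<le> w s y")
        case True
        show False
        proof (rule transport_no_interior_minimum[where u = "\<lambda>s x. u s x + e * s" and w = "\<lambda>s x. w s x + e * s"
              and lam = lam and e = e and c = c and D = "ux s y" and x = y and t = s and T = T])
          show "((\<lambda>r. u r y + e * r) has_real_derivative
              c * ux s y + lam * (w s y + e * s - (u s y + e * s)) + e) (at s within {0..T})"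
            using du[of s y] s by (auto intro!: derivative_eq_intros)
          show "((\<lambda>h. u s (y + torus_of h) + e * s) has_real_derivative ux s y) (at 0)"
            using dux[of s y] s by (auto intro!: derivative_eq_intros)
          show "u s y + e * s \<le> u r z + e * r" if "0 \<le> r" "r \<le> s" for r z
            using mle[of r z] that True s by (simp add: m_def sy min_def split: if_splits)
        qed (use True s e \<open>s > 0\<close> \<open>lam \<ge> 0\<close> in auto)
      next
        case False
        show False
        proof (rule transport_no_interior_minimum[where u = "\<lambda>s x. w s x + e * s" and w = "\<lambda>s x. u s x + e * s"
              and lam = lam and e = e and c = d and D = "wx s y" and x = y and t = s and T = T])
          show "((\<lambda>r. w r y + e * r) has_real_derivative
              d * wx s y + lam * (u s y + e * s - (w s y + e * s)) + e) (at s within {0..T})"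
            using dw[of s y] s by (auto intro!: derivative_eq_intros)
          show "((\<lambda>h. w s (y + torus_of h) + e * s) has_real_derivative wx s y) (at 0)"
            using dwx[of s y] s by (auto intro!: derivative_eq_intros)
          show "w s y + e * s \<le> w r z + e * r" if "0 \<le> r" "r \<le> s" for r z
            using mle[of r z] that False s by (simp add: m_def sy min_def split: if_splits)
        qed (use False s e \<open>s > 0\<close> \<open>lam \<ge> 0\<close> in auto)
      qed
    qed
    then have "m p \<ge> 0" using init by (simp add: m_def sy)
    then have "m (t, x) \<ge> 0" using mle[of t x] t by simp
    then show ?thesis unfolding m_def fst_conv snd_conv by linarith
  qed
  have T: "T \<ge> 0" using t by simp
  \<comment> \<open>The choice e = r / (T + 1) gives e t \<le> r, with a positive denominator also
    for T = 0; then r is arbitrary.\<close>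
  have "0 \<le> u t x + r \<and> 0 \<le> w t x + r" if "r > 0" for r
  proof -
    have "r / (T + 1) * t \<le> r / (T + 1) * (T + 1)" using t T that by (intro mult_left_mono) auto
    then have "r / (T + 1) * t \<le> r" using T by simp
    then show ?thesis using main[of "r / (T + 1)" t x] t T that by fastforce
  qed
  then show ?thesis using field_le_epsilon[of 0] by blast
qed

section \<open>The Fourier--Cattaneo system\<close>

text \<open>Narrow continuity makes the integrand continuous in time, so the integrated equation can
  be differentiated by the fundamental theorem, one-sidedly at the end points.\<close>

lemma integral_equation_derivative:
  fixes F h :: "real \<Rightarrow> real"
  assumes eq: "\<And>s t. 0 \<le> s \<Longrightarrow> s \<le> t \<Longrightarrow> t \<le> T \<Longrightarrow> F t - F s = (LBINT r:{s..t}. h r)"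
    and h: "continuous_on {0..T} h" and t: "t \<in> {0..T}"
  shows "(F has_real_derivative h t) (at t within {0..T})"
proof (rule has_field_derivative_transform_within[where d = 1])
  show "((\<lambda>s. F 0 + integral {0..s} h) has_real_derivative h t) (at t within {0..T})"
    using integral_has_real_derivative[OF h t] by (auto intro!: derivative_eq_intros)
  show "F 0 + integral {0..s} h = F s" if "s \<in> {0..T}" for s
  proof -
    have "set_integrable lborel {0..s} h"
      by (rule borel_integrable_atLeastAtMost'[OF continuous_on_subset[OF h]]) (use that in auto)
    then show ?thesis
      using eq[of 0 s] that by (simp add: set_borel_integral_eq_integral(2))
  qed
qed (use t in auto)

text \<open>Stated for functionals P and W instead of measures, so that it covers both a single
  solution, for domination, and the difference of two solutions, for uniqueness, where P does not
  come from a probability measure. The conclusion says that V P \<plusminus> W are nonnegative at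
  f.\<close>

lemma fourier_cattaneo_nonneg:
  fixes P W :: "real \<Rightarrow> (torus \<Rightarrow> real) \<Rightarrow> real"
  assumes V: "V > 0" and lam: "lam \<ge> 0"
    and P: "\<And>t. t \<in> {0..T} \<Longrightarrow> bounded_functional borel (P t)"
    and W: "\<And>t. t \<in> {0..T} \<Longrightarrow> bounded_functional borel (W t)"
    and contP: "\<And>f. continuous_on UNIV f \<Longrightarrow> continuous_on {0..T} (\<lambda>t. P t f)"
    and contW: "\<And>f. continuous_on UNIV f \<Longrightarrow> continuous_on {0..T} (\<lambda>t. W t f)"
    and eqP: "\<And>f s t. f \<in> C1 \<Longrightarrow> 0 \<le> s \<Longrightarrow> s \<le> t \<Longrightarrow> t \<le> T \<Longrightarrow>
      P t f - P s f = (LBINT r:{s..t}. W r (dx f))"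
    and eqW: "\<And>f s t. f \<in> C1 \<Longrightarrow> 0 \<le> s \<Longrightarrow> s \<le> t \<Longrightarrow> t \<le> T \<Longrightarrow>
      W t f - W s f = V\<^sup>2 * (LBINT r:{s..t}. P r (dx f)) - 2 * lam * (LBINT r:{s..t}. W r f)"
    and init: "\<And>f. continuous_on UNIV f \<Longrightarrow> (\<And>x. f x \<ge> 0) \<Longrightarrow> \<bar>W 0 f\<bar> \<le> V * P 0 f"
    and f: "f \<in> separable" "\<And>x. f x \<ge> 0" and t: "t \<in> {0..T}"
  shows "\<bar>W t f\<bar> \<le> V * P t f"
proof -
  obtain I :: "nat set" and a b where I: "finite I" "\<And>i. i \<in> I \<Longrightarrow> a i \<in> C1" "\<And>i. i \<in> I \<Longrightarrow> b i \<in> C1"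
    "\<And>x y. f (x + y) = (\<Sum>i\<in>I. a i x * b i y)"
    using f(1) unfolding separable_def by auto
  \<comment> \<open>For a pair (\<rho>, \<omega>), p and q are 2V times the slices at velocities V
    and -V of the corresponding \<sigma>. In these variables the transport part is diagonal.\<close>
  define p where "p t g = V * P t g + W t g" for t g
  define q where "q t g = V * P t g - W t g" for t g
  have pq: "bounded_functional borel (p t)" "bounded_functional borel (q t)" if "t \<in> {0..T}" for t
    unfolding p_def[abs_def] q_def[abs_def]
    by (rule bounded_functional_add[OF bounded_functional_scale[OF P[OF that]] W[OF that]],
        rule bounded_functional_diff[OF bounded_functional_scale[OF P[OF that]] W[OF that]])
  have dP: "((\<lambda>s. P s g) has_real_derivative W t (dx g)) (at t within {0..T})"
    if "g \<in> C1" "t \<in> {0..T}" for g t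
    by (rule integral_equation_derivative[OF eqP[OF that(1)] contW[OF continuous_on_dx[OF that(1)]] that(2)])
  have dW: "((\<lambda>s. W s g) has_real_derivative V\<^sup>2 * P t (dx g) - 2 * lam * W t g) (at t within {0..T})"
    if g: "g \<in> C1" and t: "t \<in> {0..T}" for g t
  proof (rule integral_equation_derivative[OF _ _ t])
    note c = contP[OF continuous_on_dx[OF g]] contW[OF continuous_on_C1[OF g]]
    show "continuous_on {0..T} (\<lambda>t. V\<^sup>2 * P t (dx g) - 2 * lam * W t g)"
      by (intro continuous_intros c)
    fix s t assume st: "0 \<le> s" "s \<le> t" "t \<le> T"
    have "set_integrable lborel {s..t} (\<lambda>r. P r (dx g))" "set_integrable lborel {s..t} (\<lambda>r. W r g)"
      by (rule borel_integrable_atLeastAtMost', rule continuous_on_subset[OF c(1)], use st in auto)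
        (rule borel_integrable_atLeastAtMost', rule continuous_on_subset[OF c(2)], use st in auto)
    then show "W t g - W s g = (LBINT r:{s..t}. V\<^sup>2 * P r (dx g) - 2 * lam * W r g)"
      using eqW[OF g st] by simp
  qed
  have dp: "((\<lambda>s. p s g) has_real_derivative V * p t (dx g) + lam * (q t g - p t g)) (at t within {0..T})"
    and dq: "((\<lambda>s. q s g) has_real_derivative - V * q t (dx g) + lam * (p t g - q t g)) (at t within {0..T})"
    if "g \<in> C1" "t \<in> {0..T}" for g t
    using dP[OF that] dW[OF that] unfolding p_def q_def
    by (auto intro!: derivative_eq_intros simp: algebra_simps power2_eq_square)
  have bm: "b i \<in> bounded_measurable borel" "dx (b i) \<in> bounded_measurable borel" if "i \<in> I" for i
    using I(3)[OF that] by (auto intro: bounded_measurable_continuous continuous_on_C1 continuous_on_dx)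
  have expand: "L (\<lambda>y. \<Sum>i\<in>I. c i * g i y) = (\<Sum>i\<in>I. c i * L (g i))"
    if L: "bounded_functional borel L" and g: "\<And>i. i \<in> I \<Longrightarrow> g i \<in> bounded_measurable borel" for L c g
    by (subst functional_sum[OF L]) (auto intro!: bounded_measurable_scale sum.cong g functional_scale[OF L])
  \<comment> \<open>Differentiating f(x + y) in x or in y gives the same result. This turns the test
    function derivative that the weak equations produce into a derivative with respect to x.\<close>
  have dxf: "(\<Sum>i\<in>I. a i x * dx (b i) y) = (\<Sum>i\<in>I. dx (a i) x * b i y)" for x y
  proof (rule DERIV_unique)
    show "((\<lambda>h. f (x + torus_of h + y)) has_real_derivative (\<Sum>i\<in>I. dx (a i) x * b i y)) (at 0)"
      unfolding I(4) by (intro DERIV_sum DERIV_cmult_right C1_has_derivative I)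
    show "((\<lambda>h. f (x + torus_of h + y)) has_real_derivative (\<Sum>i\<in>I. a i x * dx (b i) y)) (at 0)"
      unfolding add.assoc add.commute[of "torus_of _" y] I(4)
      by (intro DERIV_sum DERIV_cmult C1_has_derivative I)
  qed
  \<comment> \<open>As finite sums, u and w are jointly continuous: each coefficient is continuous
    in t and each factor in x. The identities below identify them with p and q tested against the
    translate of f by x, so their positivity at x = 0 is the claim.\<close>
  define u where "u t x = (\<Sum>i\<in>I. a i x * p t (b i))" for t x
  define w where "w t x = (\<Sum>i\<in>I. a i x * q t (b i))" for t x
  define ux where "ux t x = (\<Sum>i\<in>I. dx (a i) x * p t (b i))" for t x
  define wx where "wx t x = (\<Sum>i\<in>I. dx (a i) x * q t (b i))" for t x
  have u: "u t x = p t (\<lambda>y. f (x + y))" and w: "w t x = q t (\<lambda>y. f (x + y))" if "t \<in> {0..T}" for t x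
    unfolding u_def w_def I(4)
    by (rule expand[OF pq(1)[OF that] bm(1), symmetric], assumption,
        rule expand[OF pq(2)[OF that] bm(1), symmetric], assumption)
  have ux: "ux t x = (\<Sum>i\<in>I. a i x * p t (dx (b i)))" and wx: "wx t x = (\<Sum>i\<in>I. a i x * q t (dx (b i)))"
    if "t \<in> {0..T}" for t x
    unfolding ux_def wx_def using expand[OF pq(1)[OF that], of b "\<lambda>i. dx (a i) x"]
      expand[OF pq(1)[OF that], of "\<lambda>i. dx (b i)" "\<lambda>i. a i x"]
      expand[OF pq(2)[OF that], of b "\<lambda>i. dx (a i) x"]
      expand[OF pq(2)[OF that], of "\<lambda>i. dx (b i)" "\<lambda>i. a i x"] bm dxf by simp_all
  have ft: "continuous_on UNIV (\<lambda>y. f (x + y))" for x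
    by (rule continuous_on_compose2[OF continuous_on_C1[OF separable_C1[OF f(1)]] continuous_on_torus_translate]) simp
  have "u t 0 \<ge> 0 \<and> w t 0 \<ge> 0"
  proof (rule transport_minimum_principle[where u = u and w = w and t = t and x = 0 and ux = ux and wx = wx and c = V and d = "- V" and lam = lam and T = T])
    have pqc: "continuous_on {0..T} (\<lambda>t. p t (b i))" "continuous_on {0..T} (\<lambda>t. q t (b i))" if "i \<in> I" for i
      unfolding p_def q_def using continuous_on_C1[OF I(3)[OF that]]
      by (auto intro!: continuous_intros contP contW)
    have "continuous_on ({0..T} \<times> UNIV) (\<lambda>z :: real \<times> torus. p (fst z) (b i))"
      "continuous_on ({0..T} \<times> UNIV) (\<lambda>z :: real \<times> torus. q (fst z) (b i))" if "i \<in> I" for i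
      by (rule continuous_on_compose2[OF pqc(1)[OF that] continuous_on_fst[OF continuous_on_id]], force)
        (rule continuous_on_compose2[OF pqc(2)[OF that] continuous_on_fst[OF continuous_on_id]], force)
    moreover have "continuous_on ({0..T} \<times> UNIV) (\<lambda>z :: real \<times> torus. a i (snd z))" if "i \<in> I" for i
      by (rule continuous_on_compose2[OF continuous_on_C1[OF I(2)[OF that]]
          continuous_on_snd[OF continuous_on_id]]) simp
    ultimately show "continuous_on ({0..T} \<times> UNIV) (\<lambda>p. u (fst p) (snd p))"
        "continuous_on ({0..T} \<times> UNIV) (\<lambda>p. w (fst p) (snd p))"
      unfolding u_def w_def by (auto intro!: continuous_on_sum continuous_on_mult)
  next
    fix t x assume t: "t \<in> {0..T}"
    have "((\<lambda>s. u s x) has_real_derivative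
        (\<Sum>i\<in>I. a i x * (V * p t (dx (b i)) + lam * (q t (b i) - p t (b i))))) (at t within {0..T})"
      unfolding u_def by (intro DERIV_sum DERIV_cmult dp I t)
    then show "((\<lambda>s. u s x) has_real_derivative V * ux t x + lam * (w t x - u t x)) (at t within {0..T})"
      unfolding ux[OF t] u_def w_def
      by (simp add: sum_distrib_left sum.distrib sum_subtractf algebra_simps)
    have "((\<lambda>s. w s x) has_real_derivative
        (\<Sum>i\<in>I. a i x * (- V * q t (dx (b i)) + lam * (p t (b i) - q t (b i))))) (at t within {0..T})"
      unfolding w_def by (intro DERIV_sum DERIV_cmult dq I t)
    then show "((\<lambda>s. w s x) has_real_derivative - V * wx t x + lam * (u t x - w t x)) (at t within {0..T})"
      unfolding wx[OF t] u_def w_def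
      by (simp add: sum_distrib_left sum.distrib sum_subtractf sum_negf algebra_simps)
    show "((\<lambda>h. u t (x + torus_of h)) has_real_derivative ux t x) (at 0)"
      unfolding u_def ux_def by (intro DERIV_sum DERIV_cmult_right C1_has_derivative I)
    show "((\<lambda>h. w t (x + torus_of h)) has_real_derivative wx t x) (at 0)"
      unfolding w_def wx_def by (intro DERIV_sum DERIV_cmult_right C1_has_derivative I)
  next
    fix x
    have "0 \<in> {0..T}" using t by auto
    then show "0 \<le> u 0 x" "0 \<le> w 0 x"
      using init[OF ft, of x] f(2) by (auto simp: u w p_def q_def abs_le_iff)
  qed (use lam t in auto)
  then show ?thesis using u[OF t, of 0] w[OF t, of 0] by (simp add: p_def q_def abs_le_iff)
qed

section \<open>Curves of measures\<close>

text \<open>The narrow topology is generated by preimages of open sets under integration, and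
  continuity of a map need only be checked on a generating family.\<close>

lemma curves_iff:
  assumes S: "S \<subseteq> signed_measures M"
  shows "\<mu> \<in> curves T M S \<longleftrightarrow> (\<forall>t \<in> {0..T}. \<mu> t \<in> S) \<and>
    (\<forall>f. continuous_on (space M) f \<longrightarrow> bounded (f ` space M) \<longrightarrow>
      continuous_on {0..T} (\<lambda>t. signed_integral M (\<mu> t) f))"
proof (cases "\<forall>t \<in> {0..T}. \<mu> t \<in> S")
  case True
  let ?B = "{{\<mu> \<in> signed_measures M. signed_integral M \<mu> f \<in> U} | f U.
       continuous_on (space M) f \<and> bounded (f ` space M) \<and> open U}"
  have signed: "\<mu> t \<in> signed_measures M" if "t \<in> {0..T}" for t using True S that by blast
  \<comment> \<open>With f = 0 and U = UNIV the space of all signed measures is itself a generator.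
    So the curve takes values in the union of the generators, which is the carrier of the generated
    topology.\<close>
  have "signed_measures M = {\<mu> \<in> signed_measures M. signed_integral M \<mu> (\<lambda>_. 0) \<in> UNIV}" by simp
  then have "signed_measures M \<in> ?B"
    by (intro CollectI exI[of _ "\<lambda>_. 0"] exI[of _ UNIV]) (auto simp: image_constant_conv)
  then have cover: "\<mu> ` {0..T} \<subseteq> \<Union>?B" using signed by blast
  have pre: "\<mu> -` {\<mu> \<in> signed_measures M. signed_integral M \<mu> f \<in> U} \<inter> {0..T} =
      {0..T} \<inter> (\<lambda>t. signed_integral M (\<mu> t) f) -` U" for f U
    using signed by auto
  have "\<mu> \<in> curves T M S \<longleftrightarrow> continuous_map (top_of_set {0..T}) (topology_generated_by ?B) \<mu>"
    using True unfolding curves_def narrow_topology_def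
    by (auto simp: continuous_map_in_subtopology)
  also have "\<dots> \<longleftrightarrow> (\<forall>V. V \<in> ?B \<longrightarrow> openin (top_of_set {0..T}) (\<mu> -` V \<inter> {0..T}))"
    using cover by (simp add: continuous_on_generated_topo_iff)
  also have "\<dots> \<longleftrightarrow> (\<forall>f. continuous_on (space M) f \<longrightarrow> bounded (f ` space M) \<longrightarrow>
      (\<forall>U. open U \<longrightarrow> openin (top_of_set {0..T}) ({0..T} \<inter> (\<lambda>t. signed_integral M (\<mu> t) f) -` U)))"
    unfolding pre[symmetric] by blast
  finally show ?thesis
    using True by (simp add: continuous_openin_preimage_eq)
next
  case False
  then show ?thesis unfolding curves_def by (auto simp: continuous_map_in_subtopology)
qed

lemma prob_measuresD:
  assumes "\<mu> \<in> prob_measures M"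
  shows "\<mu> \<in> signed_measures M" "0 \<le> \<mu> A" "\<mu> A \<le> 1" "\<mu> (space M) = 1"
proof -
  obtain N where N: "\<mu> = measure N" "prob_space N" "sets N = sets M"
    using assms unfolding prob_measures_def by blast
  interpret prob_space N by fact
  show "\<mu> \<in> signed_measures M" using assms prob_measures_subset_signed by blast
  show "0 \<le> \<mu> A" "\<mu> A \<le> 1" "\<mu> (space M) = 1"
    using prob_space sets_eq_imp_space_eq[OF N(3)] by (simp_all add: N(1))
qed

lemma signed_integral_nonneg:
  assumes mu: "\<mu> \<in> signed_measures M" and nonneg: "\<And>A. A \<in> sets M \<Longrightarrow> \<mu> A \<ge> 0"
    and f: "\<And>x. x \<in> space M \<Longrightarrow> f x \<ge> 0"
  shows "signed_integral M \<mu> f \<ge> 0"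
proof -
  have "signed_integral M \<mu> f = integral\<^sup>L (pos_part M \<mu>) f"
    using signed_integral_measure[OF finite_measure_pos_part[OF mu] sets_pos_part]
    by (subst nonneg_signed_measure_eq_measure[OF mu nonneg])
  also have "\<dots> \<ge> 0" using f by (intro Bochner_Integration.integral_nonneg) simp
  finally show ?thesis .
qed

section \<open>The transformation between the two systems\<close>

lemma space_Omega: "space (Omega V) = UNIV \<times> {-V, V}"
  by (simp add: Omega_def space_restrict_space)

lemma fst_measurable_Omega: "fst \<in> Omega V \<rightarrow>\<^sub>M borel"
  unfolding Omega_def
  by (intro measurable_restrict_space1 borel_measurable_continuous_onI continuous_intros)

lemma snd_bounded_measurable_Omega: "snd \<in> bounded_measurable (Omega V)"
proof (rule bounded_measurableI)
  show "snd \<in> borel_measurable (Omega V)"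
    unfolding Omega_def
    by (intro measurable_restrict_space1 borel_measurable_continuous_onI continuous_intros)
qed (auto simp: space_Omega)

lemma signed_measures_slice:
  assumes sig: "\<sigma> \<in> signed_measures (Omega V)" and v: "v \<in> {-V, V}"
  shows "(\<lambda>A. \<sigma> (A \<times> {v})) \<in> signed_measures borel"
  unfolding signed_measures_def
proof (intro CollectI conjI allI impI)
  fix A :: "torus set" assume "A \<notin> sets borel"
  then show "\<sigma> (A \<times> {v}) = 0"
    using Times_sets_Omega[OF v] by (intro signed_measure_notin[OF sig]) simp
next
  fix A :: "nat \<Rightarrow> torus set" assume A: "range A \<subseteq> sets borel" "disjoint_family A"
  have "(\<lambda>i. \<sigma> (A i \<times> {v})) sums \<sigma> (\<Union>i. A i \<times> {v})"
    using A Times_sets_Omega[OF v]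
    by (intro signed_measure_sums[OF sig]) (auto simp: disjoint_family_on_def)
  moreover have "(\<Union>i. A i \<times> {v}) = (\<Union>i. A i) \<times> {v}" by blast
  ultimately show "(\<lambda>i. \<sigma> (A i \<times> {v})) sums \<sigma> ((\<Union>i. A i) \<times> {v})" by simp
qed

section \<open>Integrals against a fixed measure on phase space and against its two velocity
  moments\<close>

context
  fixes V :: real and \<sigma> :: "(torus \<times> real) set \<Rightarrow> real" and \<rho> \<omega> :: "torus set \<Rightarrow> real"
  assumes V: "V > 0" and sig: "\<sigma> \<in> signed_measures (Omega V)" and eq: "(\<rho>, \<omega>) = Pi_V V \<sigma>"
begin

lemma Pi_V_apply:
  "\<rho> A = \<sigma> (A \<times> {-V}) + \<sigma> (A \<times> {V})" "\<omega> A = - V * \<sigma> (A \<times> {-V}) + V * \<sigma> (A \<times> {V})"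
  using V eq by (simp_all add: Pi_V_def)

lemma Pi_V_signed_measures: "\<rho> \<in> signed_measures borel" "\<omega> \<in> signed_measures borel"
proof -
  note slice = signed_measures_slice[OF sig, of "-V"] signed_measures_slice[OF sig, of V]
  have "\<rho> = (\<lambda>A. \<sigma> (A \<times> {-V}) + \<sigma> (A \<times> {V}))"
    "\<omega> = (\<lambda>A. - V * \<sigma> (A \<times> {-V}) + V * \<sigma> (A \<times> {V}))"
    using Pi_V_apply by (simp_all add: fun_eq_iff)
  then show "\<rho> \<in> signed_measures borel" "\<omega> \<in> signed_measures borel"
    using signed_measures_add[OF slice]
      signed_measures_add[OF signed_measures_scale[OF slice(1), of "-V"] signed_measures_scale[OF slice(2), of V]]
    by simp_all
qed

text \<open>On the phase space the integrand is a combination of the indicators of two slices;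
  elsewhere the functions may differ, which the functional ignores. It is used with w constantly 1
  for \<rho> and with w the identity for \<omega>.\<close>

lemma signed_integral_slices:
  assumes A: "A \<in> sets borel" and w: "(\<lambda>p. w (snd p)) \<in> bounded_measurable (Omega V)"
  shows "signed_integral (Omega V) \<sigma> (\<lambda>p. w (snd p) * indicator A (fst p)) =
    w (-V) * \<sigma> (A \<times> {-V}) + w V * \<sigma> (A \<times> {V})"
proof -
  note L = bounded_functional_signed_integral[OF sig]
  have sets: "A \<times> {-V} \<in> sets (Omega V)" "A \<times> {V} \<in> sets (Omega V)"
    using A by (simp_all add: Times_sets_Omega)
  note bm = bounded_measurable_indicator[OF sets(1)] bounded_measurable_indicator[OF sets(2)]
  have "signed_integral (Omega V) \<sigma> (\<lambda>p. w (snd p) * indicator A (fst p)) =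
    signed_integral (Omega V) \<sigma> (\<lambda>p. w (-V) * indicator (A \<times> {-V}) p + w V * indicator (A \<times> {V}) p)"
  proof (rule functional_cong[OF L])
    show "(\<lambda>p. w (snd p) * indicator A (fst p)) \<in> bounded_measurable (Omega V)"
      by (intro bounded_measurable_mult w
          bounded_measurable_comp[OF bounded_measurable_indicator[OF A] fst_measurable_Omega])
    show "(\<lambda>p. w (-V) * indicator (A \<times> {-V}) p + w V * indicator (A \<times> {V}) p) \<in> bounded_measurable (Omega V)"
      by (intro bounded_measurable_add bounded_measurable_scale bm)
  qed (use V in \<open>auto simp: space_Omega indicator_def\<close>)
  also have "\<dots> = w (-V) * \<sigma> (A \<times> {-V}) + w V * \<sigma> (A \<times> {V})"
    by (simp only: functional_add[OF L bounded_measurable_scale[OF bm(1)] bounded_measurable_scale[OF bm(2)]]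
        functional_scale[OF L bm(1)] functional_scale[OF L bm(2)]
        signed_integral_indicator[OF sig sets(1)] signed_integral_indicator[OF sig sets(2)])
  finally show ?thesis .
qed

text \<open>In each equation both sides are bounded functionals of f, and on indicators they agree
  by the definition of the moments.\<close>

lemma Pi_V_signed_integral:
  assumes f: "f \<in> bounded_measurable borel"
  shows "signed_integral borel \<rho> f = signed_integral (Omega V) \<sigma> (\<lambda>p. f (fst p))"
    "signed_integral borel \<omega> f = signed_integral (Omega V) \<sigma> (\<lambda>p. snd p * f (fst p))"
proof -
  note L = bounded_functional_pullback[OF bounded_functional_signed_integral[OF sig] fst_measurable_Omega]
  have "signed_integral borel \<rho> f = signed_integral (Omega V) \<sigma> (\<lambda>p. 1 * f (fst p))"
  proof (rule signed_integral_eqI[OF Pi_V_signed_measures(1) L[OF bounded_measurable_const] _ f])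
    fix A :: "torus set" assume "A \<in> sets borel"
    from signed_integral_slices[OF this, of "\<lambda>_. 1", OF bounded_measurable_const]
    show "signed_integral (Omega V) \<sigma> (\<lambda>p. 1 * indicator A (fst p)) = \<rho> A"
      by (simp add: Pi_V_apply)
  qed
  then show "signed_integral borel \<rho> f = signed_integral (Omega V) \<sigma> (\<lambda>p. f (fst p))" by simp
  show "signed_integral borel \<omega> f = signed_integral (Omega V) \<sigma> (\<lambda>p. snd p * f (fst p))"
    by (rule signed_integral_eqI[OF Pi_V_signed_measures(2) L[OF snd_bounded_measurable_Omega] _ f])
      (simp only: signed_integral_slices[where w = "\<lambda>v. v"] snd_bounded_measurable_Omega Pi_V_apply)
qed

text \<open>The splitting into even and odd part in v. A function on two velocities is affine in v,
  which is why the moments of order 0 and 1 determine \<sigma>.\<close>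

lemma Omega_decomposition:
  fixes \<phi> :: "torus \<times> real \<Rightarrow> real"
  assumes "p \<in> space (Omega V)"
  shows "\<phi> p = 1/2 * (\<phi> (fst p, V) + \<phi> (fst p, -V)) + 1/(2*V) * (snd p * (\<phi> (fst p, V) - \<phi> (fst p, -V)))"
  using assms V by (auto simp: space_Omega field_simps)

lemma bounded_measurable_decomposition:
  assumes "a \<in> bounded_measurable borel" "b \<in> bounded_measurable borel"
  shows "(\<lambda>p. a (fst p) + b (fst p)) \<in> bounded_measurable (Omega V)"
    "(\<lambda>p. snd p * (a (fst p) - b (fst p))) \<in> bounded_measurable (Omega V)"
  by (intro bounded_measurable_add bounded_measurable_mult bounded_measurable_diff
      snd_bounded_measurable_Omega bounded_measurable_comp[OF _ fst_measurable_Omega] assms)+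

lemma bounded_measurable_Omega:
  assumes "(\<lambda>x. \<phi> (x, V)) \<in> bounded_measurable borel" "(\<lambda>x. \<phi> (x, -V)) \<in> bounded_measurable borel"
  shows "\<phi> \<in> bounded_measurable (Omega V)"
proof -
  let ?g = "\<lambda>p. 1/2 * (\<phi> (fst p, V) + \<phi> (fst p, -V)) + 1/(2*V) * (snd p * (\<phi> (fst p, V) - \<phi> (fst p, -V)))"
  have "?g \<in> bounded_measurable (Omega V)"
    by (intro bounded_measurable_add[OF bounded_measurable_scale bounded_measurable_scale]
        bounded_measurable_decomposition assms)
  then obtain c where c: "?g \<in> borel_measurable (Omega V)" "\<And>p. p \<in> space (Omega V) \<Longrightarrow> \<bar>?g p\<bar> \<le> c"
    by (rule bounded_measurableE) blast
  show ?thesis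
  proof (rule bounded_measurableI[of _ _ c])
    show "\<phi> \<in> borel_measurable (Omega V)"
      by (rule measurable_cong[THEN iffD2, OF _ c(1)]) (rule Omega_decomposition)
    show "\<bar>\<phi> p\<bar> \<le> c" if "p \<in> space (Omega V)" for p
      using c(2)[OF that] by (subst Omega_decomposition[OF that])
  qed
qed

lemma signed_integral_Omega:
  assumes a: "(\<lambda>x. \<phi> (x, V)) \<in> bounded_measurable borel"
    and b: "(\<lambda>x. \<phi> (x, -V)) \<in> bounded_measurable borel"
  shows "signed_integral (Omega V) \<sigma> \<phi> =
    (signed_integral borel \<rho> (\<lambda>x. \<phi> (x, V)) + signed_integral borel \<rho> (\<lambda>x. \<phi> (x, -V)) +
     (signed_integral borel \<omega> (\<lambda>x. \<phi> (x, V)) - signed_integral borel \<omega> (\<lambda>x. \<phi> (x, -V))) / V) / 2"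
proof -
  note L = bounded_functional_signed_integral[OF sig]
  note bm = bounded_measurable_decomposition[OF a b]
  have "signed_integral (Omega V) \<sigma> \<phi> = signed_integral (Omega V) \<sigma>
      (\<lambda>p. 1/2 * (\<phi> (fst p, V) + \<phi> (fst p, -V)) + 1/(2*V) * (snd p * (\<phi> (fst p, V) - \<phi> (fst p, -V))))"
    by (rule functional_cong[OF L bounded_measurable_Omega[OF a b]
          bounded_measurable_add[OF bounded_measurable_scale[OF bm(1)] bounded_measurable_scale[OF bm(2)]]
          Omega_decomposition])
  also have "\<dots> = 1/2 * signed_integral (Omega V) \<sigma> (\<lambda>p. \<phi> (fst p, V) + \<phi> (fst p, -V)) +
      1/(2*V) * signed_integral (Omega V) \<sigma> (\<lambda>p. snd p * (\<phi> (fst p, V) - \<phi> (fst p, -V)))"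
    by (simp only: functional_add[OF L bounded_measurable_scale[OF bm(1)] bounded_measurable_scale[OF bm(2)]]
        functional_scale[OF L bm(1)] functional_scale[OF L bm(2)])
  also have "signed_integral (Omega V) \<sigma> (\<lambda>p. \<phi> (fst p, V) + \<phi> (fst p, -V)) =
      signed_integral borel \<rho> (\<lambda>x. \<phi> (x, V) + \<phi> (x, -V))"
    by (rule Pi_V_signed_integral(1)[OF bounded_measurable_add[OF a b], symmetric])
  also have "signed_integral (Omega V) \<sigma> (\<lambda>p. snd p * (\<phi> (fst p, V) - \<phi> (fst p, -V))) =
      signed_integral borel \<omega> (\<lambda>x. \<phi> (x, V) - \<phi> (x, -V))"
    by (rule Pi_V_signed_integral(2)[OF bounded_measurable_diff[OF a b], symmetric])
  finally show ?thesis
    unfolding functional_add[OF bounded_functional_signed_integral[OF Pi_V_signed_measures(1)] a b]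
      functional_diff[OF bounded_functional_signed_integral[OF Pi_V_signed_measures(2)] a b]
    using V by (simp add: field_simps)
qed

text \<open>The exchange term \<phi> \<circ> iota - \<phi> is odd in v and equals -2 times the odd
  part of \<phi>. Hence it is seen by \<omega> alone, which is the origin of the damping 2 \<lambda>
  \<omega>; in the transport term the factor v interchanges even and odd parts.\<close>

lemma signed_integral_generator:
  assumes \<phi>: "\<phi> \<in> C10 V"
  shows "signed_integral (Omega V) \<sigma>
      (\<lambda>(x, v). v * dx (\<lambda>y. \<phi> (y, v)) x + lam * ((\<phi> \<circ> iota) (x, v) - \<phi> (x, v))) =
    (V * (signed_integral borel \<rho> (dx (\<lambda>x. \<phi> (x, V))) - signed_integral borel \<rho> (dx (\<lambda>x. \<phi> (x, -V)))) +
     signed_integral borel \<omega> (dx (\<lambda>x. \<phi> (x, V))) + signed_integral borel \<omega> (dx (\<lambda>x. \<phi> (x, -V))) +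
     2 * lam / V * (signed_integral borel \<omega> (\<lambda>x. \<phi> (x, -V)) - signed_integral borel \<omega> (\<lambda>x. \<phi> (x, V)))) / 2"
proof -
  define a b where "a x = \<phi> (x, V)" and "b x = \<phi> (x, -V)" for x
  have "a \<in> C1" "b \<in> C1" using \<phi> by (simp_all add: C10_def a_def[abs_def] b_def[abs_def])
  then have bm: "a \<in> bounded_measurable borel" "b \<in> bounded_measurable borel"
    "dx a \<in> bounded_measurable borel" "dx b \<in> bounded_measurable borel"
    by (auto intro: bounded_measurable_continuous continuous_on_C1 continuous_on_dx)
  let ?G = "\<lambda>(x, v). v * dx (\<lambda>y. \<phi> (y, v)) x + lam * ((\<phi> \<circ> iota) (x, v) - \<phi> (x, v))"
  have G: "(\<lambda>x. ?G (x, V)) = (\<lambda>x. V * dx a x + lam * (b x - a x))"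
    "(\<lambda>x. ?G (x, -V)) = (\<lambda>x. - V * dx b x + lam * (a x - b x))"
    by (simp_all add: a_def[abs_def] b_def[abs_def] iota_def)
  have Gbm: "(\<lambda>x. c * f x + lam * (g x - h x)) \<in> bounded_measurable borel"
    if "f \<in> bounded_measurable borel" "g \<in> bounded_measurable borel" "h \<in> bounded_measurable borel"
    for c and f g h :: "torus \<Rightarrow> real"
    by (rule bounded_measurable_add[OF bounded_measurable_scale[OF that(1)]
          bounded_measurable_scale[OF bounded_measurable_diff[OF that(2,3)]]])
  have expand: "L (\<lambda>x. c * f x + lam * (g x - h x)) = c * L f + lam * (L g - L h)"
    if L: "bounded_functional borel L" and fgh: "f \<in> bounded_measurable borel"
      "g \<in> bounded_measurable borel" "h \<in> bounded_measurable borel"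
    for c L and f g h :: "torus \<Rightarrow> real"
    by (simp only: functional_add[OF L bounded_measurable_scale[OF fgh(1)]
          bounded_measurable_scale[OF bounded_measurable_diff[OF fgh(2,3)]]]
        functional_scale[OF L fgh(1)] functional_scale[OF L bounded_measurable_diff[OF fgh(2,3)]]
        functional_diff[OF L fgh(2,3)])
  note R = bounded_functional_signed_integral[OF Pi_V_signed_measures(1)]
  note W = bounded_functional_signed_integral[OF Pi_V_signed_measures(2)]
  have "signed_integral (Omega V) \<sigma> ?G =
    (signed_integral borel \<rho> (\<lambda>x. V * dx a x + lam * (b x - a x)) +
     signed_integral borel \<rho> (\<lambda>x. - V * dx b x + lam * (a x - b x)) +
     (signed_integral borel \<omega> (\<lambda>x. V * dx a x + lam * (b x - a x)) -
      signed_integral borel \<omega> (\<lambda>x. - V * dx b x + lam * (a x - b x))) / V) / 2"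
    by (subst signed_integral_Omega; simp only: G Gbm bm)
  also have "\<dots> = (V * (signed_integral borel \<rho> (dx a) - signed_integral borel \<rho> (dx b)) +
     signed_integral borel \<omega> (dx a) + signed_integral borel \<omega> (dx b) +
     2 * lam / V * (signed_integral borel \<omega> b - signed_integral borel \<omega> a)) / 2"
    unfolding expand[OF R bm(3,2,1)] expand[OF R bm(4,1,2)] expand[OF W bm(3,2,1)] expand[OF W bm(4,1,2)]
    using V by (simp add: field_simps)
  finally show ?thesis unfolding a_def[abs_def] b_def[abs_def] .
qed

end

text \<open>The set function is half the sum of the images of \<rho> - \<omega> / V and \<rho> +
  \<omega> / V under the embeddings at velocities -V and V.\<close>

lemma Pi_V_inv_signed_measures:
  assumes "\<rho> \<in> signed_measures borel" "\<omega> \<in> signed_measures borel" "V > 0"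
  shows "Pi_V_inv V (\<rho>, \<omega>) \<in> signed_measures (Omega V)"
proof -
  have emb: "(\<lambda>x. (x, v)) \<in> borel \<rightarrow>\<^sub>M Omega V" if "v \<in> {-V, V}" for v
    unfolding Omega_def using that
    by (intro measurable_restrict_space2 borel_measurable_continuous_onI continuous_intros) auto
  let ?r = "\<lambda>\<mu> v B. if B \<in> sets (Omega V) then \<mu> ((\<lambda>x. (x, v)) -` B \<inter> space borel) else 0"
  have "(\<lambda>B. ((?r \<rho> (-V) B + (- 1 / V) * ?r \<omega> (-V) B)) + (?r \<rho> V B + (1 / V) * ?r \<omega> V B))
      \<in> signed_measures (Omega V)"
    by (intro signed_measures_add signed_measures_scale signed_measures_image assms emb) auto
  then have "(\<lambda>B. 1 / 2 * (((?r \<rho> (-V) B + (- 1 / V) * ?r \<omega> (-V) B)) + (?r \<rho> V B + (1 / V) * ?r \<omega> V B)))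
      \<in> signed_measures (Omega V)"
    by (rule signed_measures_scale)
  moreover have "Pi_V_inv V (\<rho>, \<omega>) =
      (\<lambda>B. 1 / 2 * (((?r \<rho> (-V) B + (- 1 / V) * ?r \<omega> (-V) B)) + (?r \<rho> V B + (1 / V) * ?r \<omega> V B)))"
    using assms(3) by (auto simp: Pi_V_inv_def fun_eq_iff vimage_def field_simps)
  ultimately show ?thesis by simp
qed

section \<open>Equivalence of the weak formulations\<close>

lemma C10I:
  assumes "(\<lambda>x. \<phi> (x, V)) \<in> C1" "(\<lambda>x. \<phi> (x, -V)) \<in> C1"
  shows "\<phi> \<in> C10 V"
  using assms unfolding C10_def by simp

lemma C10D:
  assumes "\<phi> \<in> C10 V"
  shows "(\<lambda>x. \<phi> (x, V)) \<in> C1" "(\<lambda>x. \<phi> (x, -V)) \<in> C1"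
  using assms unfolding C10_def by simp_all

lemma bounded_continuous_torus:
  fixes f :: "torus \<Rightarrow> real"
  assumes "continuous_on UNIV f"
  shows "bounded (range f)"
  using bounded_measurable_continuous[OF assms] by (simp add: bounded_measurable_def)

lemma bounded_measurable_C1: "f \<in> C1 \<Longrightarrow> f \<in> bounded_measurable borel"
  by (intro bounded_measurable_continuous continuous_on_C1)

lemma set_integrable_continuous_subinterval:
  fixes h :: "real \<Rightarrow> real"
  assumes "continuous_on {0..T} h" "0 \<le> s" "t \<le> T"
  shows "set_integrable lborel {s..t} h"
  by (rule borel_integrable_atLeastAtMost'[OF continuous_on_subset[OF assms(1)]]) (use assms in auto)

lemma fc_weak_solutionD:
  assumes "fc_weak_solution V lam T d \<rho> \<omega>" "t \<in> {0..T}"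
  shows "\<rho> t \<in> prob_measures borel" "\<rho> t \<in> signed_measures borel" "\<omega> t \<in> signed_measures borel"
proof -
  have "\<rho> \<in> curves T borel (prob_measures borel)" "\<omega> \<in> curves T borel (signed_measures borel)"
    using assms(1) unfolding fc_weak_solution_def by blast+
  then show "\<rho> t \<in> prob_measures borel" "\<omega> t \<in> signed_measures borel"
    using assms(2) unfolding curves_iff[OF prob_measures_subset_signed] curves_iff[OF subset_refl] by blast+
  then show "\<rho> t \<in> signed_measures borel" using prob_measures_subset_signed by blast
qed

lemma fc_weak_solution_continuous:
  assumes "fc_weak_solution V lam T d \<rho> \<omega>" "continuous_on UNIV f"
  shows "continuous_on {0..T} (\<lambda>t. signed_integral borel (\<rho> t) f)"
    "continuous_on {0..T} (\<lambda>t. signed_integral borel (\<omega> t) f)"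
proof -
  have "\<rho> \<in> curves T borel (prob_measures borel)" "\<omega> \<in> curves T borel (signed_measures borel)"
    using assms(1) unfolding fc_weak_solution_def by blast+
  then show "continuous_on {0..T} (\<lambda>t. signed_integral borel (\<rho> t) f)"
    "continuous_on {0..T} (\<lambda>t. signed_integral borel (\<omega> t) f)"
    using assms(2) bounded_continuous_torus[OF assms(2)]
    unfolding curves_iff[OF prob_measures_subset_signed] curves_iff[OF subset_refl] space_borel by blast+
qed

lemma fc_weak_solution_eq:
  assumes "fc_weak_solution V lam T d \<rho> \<omega>" "f \<in> C1" "0 \<le> s" "s \<le> t" "t \<le> T"
  shows "signed_integral borel (\<rho> t) f - signed_integral borel (\<rho> s) f =
      (LBINT r:{s..t}. signed_integral borel (\<omega> r) (dx f))"
    "signed_integral borel (\<omega> t) f - signed_integral borel (\<omega> s) f =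
       V\<^sup>2 * (LBINT r:{s..t}. signed_integral borel (\<rho> r) (dx f)) -
       2 * lam * (LBINT r:{s..t}. signed_integral borel (\<omega> r) f)"
  using assms unfolding fc_weak_solution_def by blast+

text \<open>Each Jordan part of the whole space is a supremum of values of \<mu> or -\<mu>, so c
  bounds it. The resulting factor 2 is harmless, as the bound only serves the integrability of the
  total variation in time.\<close>

lemma tv_norm_le:
  assumes mu: "\<mu> \<in> signed_measures M" and le: "\<And>A. A \<in> sets M \<Longrightarrow> \<bar>\<mu> A\<bar> \<le> c"
  shows "tv_norm M \<mu> \<le> ennreal c + ennreal c"
  unfolding tv_norm_def neg_part_def
    emeasure_pos_part[OF mu sets.top] emeasure_pos_part[OF signed_measures_uminus[OF mu] sets.top]
  using le by (intro add_mono SUP_least ennreal_leI) (auto simp: abs_le_iff)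

lemma Pi_V_prob_measures:
  assumes V: "V > 0" and sig: "\<sigma> \<in> prob_measures (Omega V)" and eq: "(\<rho>, \<omega>) = Pi_V V \<sigma>"
  shows "\<rho> \<in> prob_measures borel" "tv_norm borel \<omega> \<le> ennreal V + ennreal V"
proof -
  note sg = prob_measuresD(1)[OF sig]
  note ap = Pi_V_apply[OF V sg eq]
  show "\<rho> \<in> prob_measures borel"
  proof (rule prob_measuresI[OF Pi_V_signed_measures(1)[OF V sg eq]])
    show "0 \<le> \<rho> A" for A using prob_measuresD(2)[OF sig] by (simp add: ap)
    have "UNIV \<times> {-V, V} = (UNIV \<times> {-V}) \<union> (UNIV \<times> {V} :: (torus \<times> real) set)" by auto
    moreover have "\<sigma> ((UNIV \<times> {-V}) \<union> (UNIV \<times> {V})) = \<sigma> (UNIV \<times> {-V}) + \<sigma> (UNIV \<times> {V})"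
      using V by (intro signed_measure_Un[OF sg]) (auto simp: Times_sets_Omega)
    ultimately show "\<rho> (space borel) = 1"
      using prob_measuresD(4)[OF sig] by (simp add: ap space_Omega)
  qed
  show "tv_norm borel \<omega> \<le> ennreal V + ennreal V"
  proof (rule tv_norm_le[OF Pi_V_signed_measures(2)[OF V sg eq]])
    fix A
    have "V * \<sigma> (A \<times> {v}) \<in> {0..V}" for v
      using prob_measuresD(2,3)[OF sig, of "A \<times> {v}"] V by (simp add: mult_left_le)
    from this[of V] this[of "-V"] show "\<bar>\<omega> A\<bar> \<le> V" by (simp add: ap abs_le_iff)
  qed
qed

section \<open>From the Kac equation to the Fourier--Cattaneo system, and uniqueness for the
  latter\<close>

lemma kac_imp_fc_weak_solution:
  assumes V: "V > 0" and kac: "kac_weak_solution V lam T \<sigma>\<^sub>0 \<sigma>"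
    and eq: "\<And>t. t \<in> {0..T} \<Longrightarrow> (\<rho> t, \<omega> t) = Pi_V V (\<sigma> t)" and T: "T > 0"
  shows "fc_weak_solution V lam T (Pi_V V \<sigma>\<^sub>0) \<rho> \<omega>"
proof -
  have prob: "\<sigma> t \<in> prob_measures (Omega V)" if "t \<in> {0..T}" for t
    using kac that unfolding kac_weak_solution_def curves_iff[OF prob_measures_subset_signed] by blast
  have cont: "continuous_on {0..T} (\<lambda>t. signed_integral (Omega V) (\<sigma> t) f)"
    if "continuous_on (space (Omega V)) f" "bounded (f ` space (Omega V))" for f
    using kac that unfolding kac_weak_solution_def curves_iff[OF prob_measures_subset_signed] by blast
  have weak: "signed_integral (Omega V) (\<sigma> t) \<phi> - signed_integral (Omega V) (\<sigma> s) \<phi> =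
       (LBINT r:{s..t}. signed_integral (Omega V) (\<sigma> r)
          (\<lambda>(x, v). v * dx (\<lambda>y. \<phi> (y, v)) x + lam * ((\<phi> \<circ> iota) (x, v) - \<phi> (x, v))))"
    if "\<phi> \<in> C10 V" "0 \<le> s" "s \<le> t" "t \<le> T" for \<phi> s t
    using kac that unfolding kac_weak_solution_def by blast
  note sg = prob_measuresD(1)[OF prob]
  note int = Pi_V_signed_integral[OF V sg eq] and gen = signed_integral_generator[OF V sg eq]
  have contRW: "continuous_on {0..T} (\<lambda>t. signed_integral borel (\<rho> t) f)"
    "continuous_on {0..T} (\<lambda>t. signed_integral borel (\<omega> t) f)"
    if f: "continuous_on UNIV f" for f
  proof -
    obtain c where c: "c \<ge> 0" "\<And>x. \<bar>f x\<bar> \<le> c"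
      using bounded_measurable_continuous[OF f] by (rule bounded_measurableE) auto
    have "continuous_on (space (Omega V)) (\<lambda>p. f (fst p))"
      by (rule continuous_on_compose2[OF f continuous_on_fst[OF continuous_on_id]]) simp
    note c1 = this and c2 = continuous_on_mult[OF continuous_on_snd[OF continuous_on_id] this]
    have "bounded ((\<lambda>p. f (fst p)) ` space (Omega V))"
      using c(2) by (auto simp: bounded_iff)
    from cont[OF c1 this] show "continuous_on {0..T} (\<lambda>t. signed_integral borel (\<rho> t) f)"
      by (rule continuous_on_eq) (simp add: int[OF _ _ bounded_measurable_continuous[OF f]])
    have "\<bar>v * f x\<bar> \<le> V * c" if "v \<in> {-V, V}" for x v
      using c(2)[of x] V that by (auto simp: abs_mult)
    then have "bounded ((\<lambda>p. snd p * f (fst p)) ` space (Omega V))"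
      by (intro boundedI[where B = "V * c"]) (auto simp: space_Omega)
    from cont[OF c2 this] show "continuous_on {0..T} (\<lambda>t. signed_integral borel (\<omega> t) f)"
      by (rule continuous_on_eq) (simp add: int[OF _ _ bounded_measurable_continuous[OF f]])
  qed
  have cur: "\<rho> \<in> curves T borel (prob_measures borel)" "\<omega> \<in> curves T borel (signed_measures borel)"
    using contRW Pi_V_prob_measures(1)[OF V prob eq] Pi_V_signed_measures(2)[OF V sg eq]
    by (simp_all add: curves_iff prob_measures_subset_signed)
  have init: "(\<rho> 0, \<omega> 0) = Pi_V V \<sigma>\<^sub>0"
    using kac eq[of 0] T unfolding kac_weak_solution_def by simp
  have "(\<integral>\<^sup>+ t \<in> {0..T}. tv_norm borel (\<omega> t) \<partial>lborel) \<le>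
      (\<integral>\<^sup>+ t. (ennreal V + ennreal V) * indicator {0..T} t \<partial>lborel)"
    using Pi_V_prob_measures(2)[OF V prob eq]
    by (intro nn_integral_mono) (auto simp: indicator_def)
  also have "\<dots> = (ennreal V + ennreal V) * ennreal T"
    using T by (simp add: nn_integral_cmult_indicator)
  also have "\<dots> < \<infinity>" by (simp add: ennreal_mult_less_top)
  finally have tv: "(\<integral>\<^sup>+ t \<in> {0..T}. tv_norm borel (\<omega> t) \<partial>lborel) < \<infinity>" .
  have eq1: "signed_integral borel (\<rho> t) f - signed_integral borel (\<rho> s) f =
      (LBINT r:{s..t}. signed_integral borel (\<omega> r) (dx f))"
    if f: "f \<in> C1" and st: "0 \<le> s" "s \<le> t" "t \<le> T" for f s t
  proof -
    \<comment> \<open>This test function is even in v: the exchange term cancels, and the transport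
      term contributes \<open>dx f\<close> against \<omega>.\<close>
    have "(\<lambda>p. f (fst p)) \<in> C10 V" using f by (intro C10I) auto
    note w = weak[OF this st] and g = gen[OF _ _ this]
    have "(LBINT r:{s..t}. signed_integral (Omega V) (\<sigma> r)
        (\<lambda>(x, v). v * dx (\<lambda>y. f (fst (y, v))) x + lam * (((\<lambda>p. f (fst p)) \<circ> iota) (x, v) - f (fst (x, v))))) =
      (LBINT r:{s..t}. signed_integral borel (\<omega> r) (dx f))"
      by (rule set_lebesgue_integral_cong) (use st g in auto)
    then show ?thesis
      using w st int(1)[of t, OF _ _ bounded_measurable_C1[OF f]]
        int(1)[of s, OF _ _ bounded_measurable_C1[OF f]] by simp
  qed
  have eq2: "signed_integral borel (\<omega> t) f - signed_integral borel (\<omega> s) f =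
      V\<^sup>2 * (LBINT r:{s..t}. signed_integral borel (\<rho> r) (dx f)) -
       2 * lam * (LBINT r:{s..t}. signed_integral borel (\<omega> r) f)"
    if f: "f \<in> C1" and st: "0 \<le> s" "s \<le> t" "t \<le> T" for f s t
  proof -
    \<comment> \<open>This one is odd in v: the transport term carries v squared, which is the
      constant V squared, and the exchange term doubles with a minus sign.\<close>
    have "(\<lambda>p. snd p * f (fst p)) \<in> C10 V"
      using C1_scale(1)[OF f, of V] C1_scale(1)[OF f, of "- V"] by (intro C10I) simp_all
    note w = weak[OF this st] and g = gen[OF _ _ this]
    have sc: "signed_integral borel \<mu> (\<lambda>x. c * h x) = c * signed_integral borel \<mu> h"
      if "\<mu> \<in> signed_measures borel" "h \<in> bounded_measurable borel" for \<mu> c h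
      by (rule functional_scale[OF bounded_functional_signed_integral[OF that(1)] that(2)])
    note bm = bounded_measurable_C1[OF f] bounded_measurable_continuous[OF continuous_on_dx[OF f]]
    have "signed_integral (Omega V) (\<sigma> r)
        (\<lambda>(x, v). v * dx (\<lambda>y. snd (y, v) * f (fst (y, v))) x +
          lam * (((\<lambda>p. snd p * f (fst p)) \<circ> iota) (x, v) - snd (x, v) * f (fst (x, v)))) =
       V\<^sup>2 * signed_integral borel (\<rho> r) (dx f) - 2 * lam * signed_integral borel (\<omega> r) f"
      if r: "r \<in> {0..T}" for r
      unfolding g[OF r r]
      unfolding fst_conv snd_conv C1_scale(2)[OF f]
        sc[OF Pi_V_signed_measures(1)[OF V sg[OF r] eq[OF r]] bm(2)]
        sc[OF Pi_V_signed_measures(2)[OF V sg[OF r] eq[OF r]] bm(1)]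
        sc[OF Pi_V_signed_measures(2)[OF V sg[OF r] eq[OF r]] bm(2)]
      using V by (simp add: field_simps power2_eq_square)
    then have "(LBINT r:{s..t}. signed_integral (Omega V) (\<sigma> r)
        (\<lambda>(x, v). v * dx (\<lambda>y. snd (y, v) * f (fst (y, v))) x +
          lam * (((\<lambda>p. snd p * f (fst p)) \<circ> iota) (x, v) - snd (x, v) * f (fst (x, v))))) =
      (LBINT r:{s..t}. V\<^sup>2 * signed_integral borel (\<rho> r) (dx f) - 2 * lam * signed_integral borel (\<omega> r) f)"
      by (intro set_lebesgue_integral_cong) (use st in auto)
    also have "\<dots> = V\<^sup>2 * (LBINT r:{s..t}. signed_integral borel (\<rho> r) (dx f)) -
       2 * lam * (LBINT r:{s..t}. signed_integral borel (\<omega> r) f)"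
      using set_integrable_continuous_subinterval[OF contRW(1)[OF continuous_on_dx[OF f]] st(1,3)]
        set_integrable_continuous_subinterval[OF contRW(2)[OF continuous_on_C1[OF f]] st(1,3)]
      by simp
    finally show ?thesis
      using w st int(2)[of t, OF _ _ bm(1)] int(2)[of s, OF _ _ bm(1)] by simp
  qed
  show ?thesis
    unfolding fc_weak_solution_def using cur init tv eq1 eq2 by blast
qed

text \<open>The system is linear, so the difference of two solutions solves it with datum 0, for
  which the initial domination holds trivially.\<close>

lemma fc_weak_solution_comparison:
  assumes "V > 0" "lam \<ge> 0"
    and sol: "fc_weak_solution V lam T d \<rho> \<omega>" "fc_weak_solution V lam T d \<rho>' \<omega>'"
    and f: "f \<in> separable" "\<And>x. f x \<ge> 0" and t: "t \<in> {0..T}"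
  shows "\<bar>signed_integral borel (\<omega> t) f - signed_integral borel (\<omega>' t) f\<bar> \<le>
    V * (signed_integral borel (\<rho> t) f - signed_integral borel (\<rho>' t) f)"
proof (rule fourier_cattaneo_nonneg[where T = T and lam = lam and
      P = "\<lambda>t f. signed_integral borel (\<rho> t) f - signed_integral borel (\<rho>' t) f" and
      W = "\<lambda>t f. signed_integral borel (\<omega> t) f - signed_integral borel (\<omega>' t) f"])
  note S1 = fc_weak_solutionD[OF sol(1)] and S2 = fc_weak_solutionD[OF sol(2)]
  show "bounded_functional borel (\<lambda>f. signed_integral borel (\<rho> t) f - signed_integral borel (\<rho>' t) f)"
    "bounded_functional borel (\<lambda>f. signed_integral borel (\<omega> t) f - signed_integral borel (\<omega>' t) f)"
    if "t \<in> {0..T}" for t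
    using S1[OF that] S2[OF that]
    by (auto intro!: bounded_functional_diff bounded_functional_signed_integral)
  note c1 = fc_weak_solution_continuous[OF sol(1)] and c2 = fc_weak_solution_continuous[OF sol(2)]
  show "continuous_on {0..T} (\<lambda>t. signed_integral borel (\<rho> t) f - signed_integral borel (\<rho>' t) f)"
    "continuous_on {0..T} (\<lambda>t. signed_integral borel (\<omega> t) f - signed_integral borel (\<omega>' t) f)"
    if "continuous_on UNIV f" for f
    using c1[OF that] c2[OF that] by (auto intro!: continuous_on_diff)
  note e1 = fc_weak_solution_eq[OF sol(1)] and e2 = fc_weak_solution_eq[OF sol(2)]
  fix g s t assume g: "g \<in> C1" and st: "0 \<le> s" "s \<le> t" "t \<le> T"
  note si = set_integrable_continuous_subinterval[OF _ st(1,3)]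
  note i1 = si[OF c1(1)] si[OF c1(2)] and i2 = si[OF c2(1)] si[OF c2(2)]
  note cg = continuous_on_C1[OF g] continuous_on_dx[OF g]
  show "signed_integral borel (\<rho> t) g - signed_integral borel (\<rho>' t) g -
      (signed_integral borel (\<rho> s) g - signed_integral borel (\<rho>' s) g) =
    (LBINT r:{s..t}. signed_integral borel (\<omega> r) (dx g) - signed_integral borel (\<omega>' r) (dx g))"
    using e1(1)[OF g st] e2(1)[OF g st] i1(2)[OF cg(2)] i2(2)[OF cg(2)] by simp
  show "signed_integral borel (\<omega> t) g - signed_integral borel (\<omega>' t) g -
      (signed_integral borel (\<omega> s) g - signed_integral borel (\<omega>' s) g) =
    V\<^sup>2 * (LBINT r:{s..t}. signed_integral borel (\<rho> r) (dx g) - signed_integral borel (\<rho>' r) (dx g)) -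
    2 * lam * (LBINT r:{s..t}. signed_integral borel (\<omega> r) g - signed_integral borel (\<omega>' r) g)"
    using e1(2)[OF g st] e2(2)[OF g st] i1(1)[OF cg(2)] i2(1)[OF cg(2)] i1(2)[OF cg(1)] i2(2)[OF cg(1)]
    by (simp add: right_diff_distrib)
next
  have "(\<rho> 0, \<omega> 0) = (\<rho>' 0, \<omega>' 0)"
    using sol unfolding fc_weak_solution_def by metis
  then show "\<bar>signed_integral borel (\<omega> 0) f - signed_integral borel (\<omega>' 0) f\<bar> \<le>
    V * (signed_integral borel (\<rho> 0) f - signed_integral borel (\<rho>' 0) f)" for f
    by simp
qed (use assms in auto)

text \<open>Positivity is applied to both \<mu> - \<nu> and \<nu> - \<mu>, so nonnegative separable
  functions are enough to determine a signed measure.\<close>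

lemma signed_measures_eqI:
  assumes mu: "\<mu> \<in> signed_measures borel" and nu: "\<nu> \<in> signed_measures borel"
    and eq: "\<And>f. f \<in> separable \<Longrightarrow> (\<And>x. f x \<ge> 0) \<Longrightarrow> signed_integral borel \<mu> f = signed_integral borel \<nu> f"
  shows "\<mu> = \<nu>"
proof
  fix A :: "torus set"
  show "\<mu> A = \<nu> A"
  proof (cases "A \<in> sets borel")
    case True
    note bm = bounded_measurable_C1[OF separable_C1]
    have "0 \<le> \<mu> A - \<nu> A" "0 \<le> \<nu> A - \<mu> A"
      by (rule signed_measure_nonneg[OF signed_measures_diff[OF mu nu] _ True],
          simp add: signed_integral_diff_measure[OF mu nu bm] eq)
        (rule signed_measure_nonneg[OF signed_measures_diff[OF nu mu] _ True],
          simp add: signed_integral_diff_measure[OF nu mu bm] eq)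
    then show ?thesis by simp
  qed (simp add: signed_measure_notin[OF mu] signed_measure_notin[OF nu])
qed

lemma fc_weak_solution_unique:
  assumes "V > 0" "lam \<ge> 0"
    and sol: "fc_weak_solution V lam T d \<rho> \<omega>" "fc_weak_solution V lam T d \<rho>' \<omega>'"
    and t: "t \<in> {0..T}"
  shows "\<rho> t = \<rho>' t" "\<omega> t = \<omega>' t"
proof -
  have eq: "signed_integral borel (\<rho> t) f = signed_integral borel (\<rho>' t) f \<and>
      signed_integral borel (\<omega> t) f = signed_integral borel (\<omega>' t) f"
    if f: "f \<in> separable" "\<And>x. f x \<ge> 0" for f
  proof -
    note * = fc_weak_solution_comparison[OF assms(1,2) sol f t]
      fc_weak_solution_comparison[OF assms(1,2) sol(2,1) f t]
    \<comment> \<open>Comparison in both orders forces the densities' integrals to agree; the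
      right-hand side of the comparison is then 0, and the flux integrals agree too.\<close>
    have "0 \<le> V * (signed_integral borel (\<rho> t) f - signed_integral borel (\<rho>' t) f)"
      "0 \<le> V * (signed_integral borel (\<rho>' t) f - signed_integral borel (\<rho> t) f)"
      using *[THEN order_trans[OF abs_ge_zero]] by blast+
    then have "signed_integral borel (\<rho> t) f = signed_integral borel (\<rho>' t) f"
      using assms(1) by (simp add: zero_le_mult_iff)
    with *(1) show ?thesis by simp
  qed
  note D = fc_weak_solutionD[OF sol(1) t] and D' = fc_weak_solutionD[OF sol(2) t]
  show "\<rho> t = \<rho>' t" by (rule signed_measures_eqI[OF D(2) D'(2)]) (simp add: eq)
  show "\<omega> t = \<omega>' t" by (rule signed_measures_eqI[OF D(3) D'(3)]) (simp add: eq)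
qed

text \<open>At time 0 the domination of sets gives positivity against continuous functions, the
  minimum principle propagates it for separable test functions, and
  \<open>signed_measure_nonneg\<close> returns from these to sets.\<close>

lemma fc_weak_solution_dominated:
  assumes V: "V > 0" and "lam \<ge> 0"
    and sol: "fc_weak_solution V lam T (\<rho>\<^sub>0, \<omega>\<^sub>0) \<rho> \<omega>"
    and dom: "\<And>A. A \<in> sets borel \<Longrightarrow> - V * \<rho>\<^sub>0 A \<le> \<omega>\<^sub>0 A \<and> \<omega>\<^sub>0 A \<le> V * \<rho>\<^sub>0 A"
    and t: "t \<in> {0..T}" and A: "A \<in> sets borel"
  shows "\<bar>\<omega> t A\<bar> \<le> V * \<rho> t A"
proof -
  note D = fc_weak_solutionD[OF sol]
  have comb: "signed_integral borel (\<lambda>A. V * \<rho> t A + \<omega> t A) f =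
      V * signed_integral borel (\<rho> t) f + signed_integral borel (\<omega> t) f"
    "signed_integral borel (\<lambda>A. V * \<rho> t A - \<omega> t A) f =
      V * signed_integral borel (\<rho> t) f - signed_integral borel (\<omega> t) f"
    if "f \<in> bounded_measurable borel" "t \<in> {0..T}" for f t
    using D[OF that(2)] that(1)
    by (simp_all add: signed_integral_add_measure signed_integral_diff_measure
        signed_integral_scale_measure signed_measures_scale)
  have T0: "0 \<in> {0..T}" using t by auto
  have zero: "\<rho> 0 = \<rho>\<^sub>0" "\<omega> 0 = \<omega>\<^sub>0" using sol unfolding fc_weak_solution_def by auto
  have nonneg: "\<bar>signed_integral borel (\<omega> t) f\<bar> \<le> V * signed_integral borel (\<rho> t) f"
    if f: "f \<in> separable" "\<And>x. f x \<ge> 0" for f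
  proof (rule fourier_cattaneo_nonneg[where T = T and lam = lam and
        P = "\<lambda>t. signed_integral borel (\<rho> t)" and W = "\<lambda>t. signed_integral borel (\<omega> t)"])
    fix g :: "torus \<Rightarrow> real" assume g: "continuous_on UNIV g" "\<And>x. g x \<ge> 0"
    note sm = signed_measures_scale[OF D(2)[OF T0], of V] D(3)[OF T0]
    have nonneg0: "0 \<le> V * \<rho> 0 A + \<omega> 0 A" "0 \<le> V * \<rho> 0 A - \<omega> 0 A" if "A \<in> sets borel" for A
      using dom[OF that] unfolding zero by simp_all
    have "0 \<le> signed_integral borel (\<lambda>A. V * \<rho> 0 A + \<omega> 0 A) g"
      by (rule signed_integral_nonneg[OF signed_measures_add[OF sm] nonneg0(1) g(2)])
    moreover have "0 \<le> signed_integral borel (\<lambda>A. V * \<rho> 0 A - \<omega> 0 A) g"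
      by (rule signed_integral_nonneg[OF signed_measures_diff[OF sm] nonneg0(2) g(2)])
    ultimately show "\<bar>signed_integral borel (\<omega> 0) g\<bar> \<le> V * signed_integral borel (\<rho> 0) g"
      using comb[OF bounded_measurable_continuous[OF g(1)] T0] by (simp add: abs_le_iff)
  next
    show "bounded_functional borel (signed_integral borel (\<rho> t))"
      "bounded_functional borel (signed_integral borel (\<omega> t))" if "t \<in> {0..T}" for t
      using D[OF that] by (auto intro: bounded_functional_signed_integral)
    show "continuous_on {0..T} (\<lambda>t. signed_integral borel (\<rho> t) g)"
      "continuous_on {0..T} (\<lambda>t. signed_integral borel (\<omega> t) g)" if "continuous_on UNIV g" for g
      by (fact fc_weak_solution_continuous[OF sol that])+
    show "signed_integral borel (\<rho> t) g - signed_integral borel (\<rho> s) g =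
        (LBINT r:{s..t}. signed_integral borel (\<omega> r) (dx g))"
      "signed_integral borel (\<omega> t) g - signed_integral borel (\<omega> s) g =
        V\<^sup>2 * (LBINT r:{s..t}. signed_integral borel (\<rho> r) (dx g)) -
        2 * lam * (LBINT r:{s..t}. signed_integral borel (\<omega> r) g)"
      if "g \<in> C1" "0 \<le> s" "s \<le> t" "t \<le> T" for g s t
      by (fact fc_weak_solution_eq[OF sol that])+
  qed (fact assms(1,2) f t)+
  note bm = bounded_measurable_C1[OF separable_C1]
  have "0 \<le> V * \<rho> t A + \<omega> t A"
  proof (rule signed_measure_nonneg[where \<mu> = "\<lambda>A. V * \<rho> t A + \<omega> t A", OF _ _ A])
    fix f assume "f \<in> separable" "\<And>x. 0 \<le> f x"
    then show "0 \<le> signed_integral borel (\<lambda>A. V * \<rho> t A + \<omega> t A) f"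
      using nonneg[of f] comb(1)[OF bm t] by (simp add: abs_le_iff)
  qed (intro signed_measures_add signed_measures_scale D t)
  moreover have "0 \<le> V * \<rho> t A - \<omega> t A"
  proof (rule signed_measure_nonneg[where \<mu> = "\<lambda>A. V * \<rho> t A - \<omega> t A", OF _ _ A])
    fix f assume "f \<in> separable" "\<And>x. 0 \<le> f x"
    then show "0 \<le> signed_integral borel (\<lambda>A. V * \<rho> t A - \<omega> t A) f"
      using nonneg[of f] comb(2)[OF bm t] by (simp add: abs_le_iff)
  qed (intro signed_measures_diff signed_measures_scale D t)
  ultimately show ?thesis by simp
qed

section \<open>From the Fourier--Cattaneo system back to the Kac equation\<close>

lemma Pi_V_inv_prob_measures:
  assumes V: "V > 0" and rho: "\<rho> \<in> prob_measures borel" and om: "\<omega> \<in> signed_measures borel"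
    and dom: "\<And>A. A \<in> sets borel \<Longrightarrow> \<bar>\<omega> A\<bar> \<le> V * \<rho> A"
  shows "Pi_V_inv V (\<rho>, \<omega>) \<in> prob_measures (Omega V)"
proof (rule prob_measuresI)
  have rs: "\<rho> \<in> signed_measures borel" using prob_measuresD(1)[OF rho] .
  show "Pi_V_inv V (\<rho>, \<omega>) \<in> signed_measures (Omega V)"
    by (rule Pi_V_inv_signed_measures[OF rs om V])
  have split: "Pi_V_inv V (\<rho>, \<omega>) B = (\<rho> {x. (x, -V) \<in> B} - \<omega> {x. (x, -V) \<in> B} / V) / 2 +
      (\<rho> {x. (x, V) \<in> B} + \<omega> {x. (x, V) \<in> B} / V) / 2" if "B \<in> sets (Omega V)" for B
    using that V by (simp add: Pi_V_inv_def)
  \<comment> \<open>Domination says precisely that \<rho> \<plusminus> \<omega> / V, twice the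
    slices, are nonnegative.\<close>
  show "0 \<le> Pi_V_inv V (\<rho>, \<omega>) B" if B: "B \<in> sets (Omega V)" for B
  proof -
    have "- \<rho> A \<le> \<omega> A / V \<and> \<omega> A / V \<le> \<rho> A" if "A \<in> sets borel" for A
      using dom[OF that] V by (simp add: abs_le_iff field_simps)
    from this[OF section_sets_Omega[OF B, of V]] this[OF section_sets_Omega[OF B, of "-V"]]
    show ?thesis unfolding split[OF B] by simp
  qed
  \<comment> \<open>Both sections of the phase space are the full torus, where the two contributions
    of \<omega> cancel.\<close>
  show "Pi_V_inv V (\<rho>, \<omega>) (space (Omega V)) = 1"
    unfolding split[OF sets.top] using prob_measuresD(4)[OF rho] signed_measure_empty[OF om]
    by (simp add: space_Omega field_simps)
qed

text \<open>With a and b the slices of the test function at V and -V, the Kac equation is half the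
  sum of the \<rho>-equation tested with a + b and 1/V times the \<omega>-equation tested with a -
  b.\<close>

lemma fc_imp_kac_weak_solution:
  assumes V: "V > 0" and lam: "lam \<ge> 0" and T: "T > 0"
    and sol: "fc_weak_solution V lam T (\<rho>\<^sub>0, \<omega>\<^sub>0) \<rho> \<omega>"
    and dom: "\<And>A. A \<in> sets borel \<Longrightarrow> - V * \<rho>\<^sub>0 A \<le> \<omega>\<^sub>0 A \<and> \<omega>\<^sub>0 A \<le> V * \<rho>\<^sub>0 A"
    and eq: "\<And>t. t \<in> {0..T} \<Longrightarrow> \<sigma> t = Pi_V_inv V (\<rho> t, \<omega> t)"
  shows "kac_weak_solution V lam T (Pi_V_inv V (\<rho>\<^sub>0, \<omega>\<^sub>0)) \<sigma>"
proof -
  note D = fc_weak_solutionD[OF sol]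
  have prob: "\<sigma> t \<in> prob_measures (Omega V)" if t: "t \<in> {0..T}" for t
    unfolding eq[OF t]
    by (rule Pi_V_inv_prob_measures[OF V D(1,3)[OF t] fc_weak_solution_dominated[OF V lam sol dom t]])
  note sg = prob_measuresD(1)[OF prob]
  have Pi: "(\<rho> t, \<omega> t) = Pi_V V (\<sigma> t)" if t: "t \<in> {0..T}" for t
    unfolding eq[OF t] using Pi_V_Pi_V_inv[OF V D(2,3)[OF t]] by simp
  note int = signed_integral_Omega[OF V sg Pi] and gen = signed_integral_generator[OF V sg Pi]
  note cont = fc_weak_solution_continuous[OF sol]
  have cur: "\<sigma> \<in> curves T (Omega V) (prob_measures (Omega V))"
    unfolding curves_iff[OF prob_measures_subset_signed]
  proof (intro conjI ballI prob allI impI)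
    fix f :: "torus \<times> real \<Rightarrow> real" assume f: "continuous_on (space (Omega V)) f"
    have c: "continuous_on UNIV (\<lambda>x. f (x, V))" "continuous_on UNIV (\<lambda>x. f (x, -V))"
      by (rule continuous_on_compose2[OF f], auto intro!: continuous_intros simp: space_Omega)+
    have "continuous_on {0..T} (\<lambda>t. (signed_integral borel (\<rho> t) (\<lambda>x. f (x, V)) +
        signed_integral borel (\<rho> t) (\<lambda>x. f (x, -V)) +
       (signed_integral borel (\<omega> t) (\<lambda>x. f (x, V)) - signed_integral borel (\<omega> t) (\<lambda>x. f (x, -V))) / V) / 2)"
      using V by (intro continuous_intros cont c) auto
    then show "continuous_on {0..T} (\<lambda>t. signed_integral (Omega V) (\<sigma> t) f)"
      by (rule continuous_on_eq) (simp add: int c bounded_measurable_continuous)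
  qed
  have weak: "signed_integral (Omega V) (\<sigma> t) \<phi> - signed_integral (Omega V) (\<sigma> s) \<phi> =
       (LBINT r:{s..t}. signed_integral (Omega V) (\<sigma> r)
          (\<lambda>(x, v). v * dx (\<lambda>y. \<phi> (y, v)) x + lam * ((\<phi> \<circ> iota) (x, v) - \<phi> (x, v))))"
    if \<phi>: "\<phi> \<in> C10 V" and st: "0 \<le> s" "s \<le> t" "t \<le> T" for \<phi> s t
  proof -
    define a b where "a x = \<phi> (x, V)" and "b x = \<phi> (x, -V)" for x
    have ab: "a \<in> C1" "b \<in> C1" using C10D[OF \<phi>] by (simp_all add: a_def[abs_def] b_def[abs_def])
    let ?P = "\<lambda>f r. signed_integral borel (\<rho> r) f" and ?W = "\<lambda>f r. signed_integral borel (\<omega> r) f"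
    \<comment> \<open>Splitting the time integral of the generator into six terms requires each of
      them to be integrable; this comes from narrow continuity.\<close>
    have SI: "set_integrable lborel {s..t} (?P f)" "set_integrable lborel {s..t} (?W f)"
      if "continuous_on UNIV f" for f
      using set_integrable_continuous_subinterval[OF _ st(1,3)] cont[OF that] by blast+
    note cab = continuous_on_C1[OF ab(1)] continuous_on_C1[OF ab(2)]
      continuous_on_dx[OF ab(1)] continuous_on_dx[OF ab(2)]
    have "(LBINT r:{s..t}. signed_integral (Omega V) (\<sigma> r)
          (\<lambda>(x, v). v * dx (\<lambda>y. \<phi> (y, v)) x + lam * ((\<phi> \<circ> iota) (x, v) - \<phi> (x, v)))) =
      (LBINT r:{s..t}. V / 2 * ?P (dx a) r - V / 2 * ?P (dx b) r + 1 / 2 * ?W (dx a) r + 1 / 2 * ?W (dx b) r +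
        lam / V * ?W b r - lam / V * ?W a r)"
    proof (rule set_lebesgue_integral_cong, simp, intro allI impI)
      fix r assume "r \<in> {s..t}"
      then have r: "r \<in> {0..T}" using st by auto
      show "signed_integral (Omega V) (\<sigma> r)
          (\<lambda>(x, v). v * dx (\<lambda>y. \<phi> (y, v)) x + lam * ((\<phi> \<circ> iota) (x, v) - \<phi> (x, v))) =
        V / 2 * ?P (dx a) r - V / 2 * ?P (dx b) r + 1 / 2 * ?W (dx a) r + 1 / 2 * ?W (dx b) r +
        lam / V * ?W b r - lam / V * ?W a r"
        unfolding gen[OF r r \<phi>] a_def[abs_def, symmetric] b_def[abs_def, symmetric]
        using V by (simp add: field_simps)
    qed
    also have "\<dots> = V / 2 * (LBINT r:{s..t}. ?P (dx a) r) - V / 2 * (LBINT r:{s..t}. ?P (dx b) r) +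
        1 / 2 * (LBINT r:{s..t}. ?W (dx a) r) + 1 / 2 * (LBINT r:{s..t}. ?W (dx b) r) +
        lam / V * (LBINT r:{s..t}. ?W b r) - lam / V * (LBINT r:{s..t}. ?W a r)"
      using SI cab by simp
    finally have rhs: "(LBINT r:{s..t}. signed_integral (Omega V) (\<sigma> r)
          (\<lambda>(x, v). v * dx (\<lambda>y. \<phi> (y, v)) x + lam * ((\<phi> \<circ> iota) (x, v) - \<phi> (x, v)))) =
        V / 2 * (LBINT r:{s..t}. ?P (dx a) r) - V / 2 * (LBINT r:{s..t}. ?P (dx b) r) +
        1 / 2 * (LBINT r:{s..t}. ?W (dx a) r) + 1 / 2 * (LBINT r:{s..t}. ?W (dx b) r) +
        lam / V * (LBINT r:{s..t}. ?W b r) - lam / V * (LBINT r:{s..t}. ?W a r)" .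
    have lhs: "signed_integral (Omega V) (\<sigma> r) \<phi> = (?P a r + ?P b r + (?W a r - ?W b r) / V) / 2"
      if "r \<in> {0..T}" for r
      using int[OF that that, of \<phi>, folded a_def[abs_def] b_def[abs_def]] ab bounded_measurable_C1 by blast
    have "signed_integral (Omega V) (\<sigma> t) \<phi> - signed_integral (Omega V) (\<sigma> s) \<phi> =
        ((?P a t - ?P a s) + (?P b t - ?P b s) + ((?W a t - ?W a s) - (?W b t - ?W b s)) / V) / 2"
      using st V by (simp add: lhs field_simps)
    also have "\<dots> = V / 2 * (LBINT r:{s..t}. ?P (dx a) r) - V / 2 * (LBINT r:{s..t}. ?P (dx b) r) +
        1 / 2 * (LBINT r:{s..t}. ?W (dx a) r) + 1 / 2 * (LBINT r:{s..t}. ?W (dx b) r) +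
        lam / V * (LBINT r:{s..t}. ?W b r) - lam / V * (LBINT r:{s..t}. ?W a r)"
      unfolding fc_weak_solution_eq[OF sol ab(1) st] fc_weak_solution_eq[OF sol ab(2) st]
      using V by (simp add: field_simps power2_eq_square)
    finally show ?thesis unfolding rhs .
  qed
  have "\<sigma> 0 = Pi_V_inv V (\<rho>\<^sub>0, \<omega>\<^sub>0)"
    using eq[of 0] T sol unfolding fc_weak_solution_def by auto
  then show ?thesis unfolding kac_weak_solution_def using cur weak by blast
qed

theorem theorem2p10:
  fixes V lam T :: real
  assumes "V > 0" and "lam > 0" and "T > 0"
  shows "(\<forall>\<sigma>\<^sub>0 \<sigma> \<rho> \<omega>.
            \<sigma>\<^sub>0 \<in> prob_measures (Omega V) \<longrightarrow>
            kac_weak_solution V lam T \<sigma>\<^sub>0 \<sigma> \<longrightarrow>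
            (\<forall>t \<in> {0..T}. (\<rho> t, \<omega> t) = Pi_V V (\<sigma> t)) \<longrightarrow>
            the_fc_weak_solution V lam T (Pi_V V \<sigma>\<^sub>0) \<rho> \<omega>) \<and>
         (\<forall>\<rho>\<^sub>0 \<omega>\<^sub>0 \<rho> \<omega> \<sigma>.
            \<rho>\<^sub>0 \<in> prob_measures borel \<longrightarrow> \<omega>\<^sub>0 \<in> signed_measures borel \<longrightarrow>
            (\<forall>A \<in> sets borel. - V * \<rho>\<^sub>0 A \<le> \<omega>\<^sub>0 A \<and> \<omega>\<^sub>0 A \<le> V * \<rho>\<^sub>0 A) \<longrightarrow>
            fc_weak_solution V lam T (\<rho>\<^sub>0, \<omega>\<^sub>0) \<rho> \<omega> \<longrightarrow>
            (\<forall>t \<in> {0..T}. \<sigma> t = Pi_V_inv V (\<rho> t, \<omega> t)) \<longrightarrow>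
            the_kac_weak_solution V lam T (Pi_V_inv V (\<rho>\<^sub>0, \<omega>\<^sub>0)) \<sigma>)"
proof (intro conjI allI impI)
  fix \<sigma>\<^sub>0 \<sigma> \<rho> \<omega>
  assume "kac_weak_solution V lam T \<sigma>\<^sub>0 \<sigma>" "\<forall>t \<in> {0..T}. (\<rho> t, \<omega> t) = Pi_V V (\<sigma> t)"
  then have "fc_weak_solution V lam T (Pi_V V \<sigma>\<^sub>0) \<rho> \<omega>"
    using assms by (intro kac_imp_fc_weak_solution) auto
  then show "the_fc_weak_solution V lam T (Pi_V V \<sigma>\<^sub>0) \<rho> \<omega>"
    unfolding the_fc_weak_solution_def
    using fc_weak_solution_unique[OF \<open>V > 0\<close> less_imp_le[OF \<open>lam > 0\<close>]] by blast
next
  fix \<rho>\<^sub>0 \<omega>\<^sub>0 \<rho> \<omega> \<sigma>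
  assume data: "\<rho>\<^sub>0 \<in> prob_measures borel" "\<omega>\<^sub>0 \<in> signed_measures borel"
    and dom: "\<forall>A \<in> sets borel. - V * \<rho>\<^sub>0 A \<le> \<omega>\<^sub>0 A \<and> \<omega>\<^sub>0 A \<le> V * \<rho>\<^sub>0 A"
    and fc: "fc_weak_solution V lam T (\<rho>\<^sub>0, \<omega>\<^sub>0) \<rho> \<omega>"
    and eq: "\<forall>t \<in> {0..T}. \<sigma> t = Pi_V_inv V (\<rho> t, \<omega> t)"
  have kac: "kac_weak_solution V lam T (Pi_V_inv V (\<rho>\<^sub>0, \<omega>\<^sub>0)) \<sigma>"
    using assms dom eq by (intro fc_imp_kac_weak_solution[OF _ _ _ fc]) auto
  \<comment> \<open>A competing Kac solution is compared through its moments. They solve the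
    Fourier--Cattaneo system with datum \<open>Pi_V\<close> of \<open>Pi_V_inv\<close> of the given
    pair, that is, the given pair itself, so they equal \<rho> and \<omega>; \<open>Pi_V_inv\<close>
    then recovers the measure.\<close>
  have "\<sigma>' t = \<sigma> t"
    if kac': "kac_weak_solution V lam T (Pi_V_inv V (\<rho>\<^sub>0, \<omega>\<^sub>0)) \<sigma>'" and t: "t \<in> {0..T}" for \<sigma>' t
  proof -
    have sg: "\<sigma>' t \<in> signed_measures (Omega V)"
      using kac' t prob_measures_subset_signed
      unfolding kac_weak_solution_def curves_iff[OF prob_measures_subset_signed] by blast
    have "fc_weak_solution V lam T (Pi_V V (Pi_V_inv V (\<rho>\<^sub>0, \<omega>\<^sub>0)))
        (\<lambda>t. fst (Pi_V V (\<sigma>' t))) (\<lambda>t. snd (Pi_V V (\<sigma>' t)))"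
      using assms by (intro kac_imp_fc_weak_solution[OF _ kac']) auto
    also have "Pi_V V (Pi_V_inv V (\<rho>\<^sub>0, \<omega>\<^sub>0)) = (\<rho>\<^sub>0, \<omega>\<^sub>0)"
      by (rule Pi_V_Pi_V_inv[OF \<open>V > 0\<close> prob_measuresD(1)[OF data(1)] data(2)])
    finally have "Pi_V V (\<sigma>' t) = (\<rho> t, \<omega> t)"
      using fc_weak_solution_unique[OF \<open>V > 0\<close> less_imp_le[OF \<open>lam > 0\<close>] _ fc t]
      by (metis prod.collapse)
    then show "\<sigma>' t = \<sigma> t"
      using Pi_V_inv_Pi_V[OF \<open>V > 0\<close> sg] eq t by simp
  qed
  with kac show "the_kac_weak_solution V lam T (Pi_V_inv V (\<rho>\<^sub>0, \<omega>\<^sub>0)) \<sigma>"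
    unfolding the_kac_weak_solution_def by blast
qed

end
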